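(* Let $q\ge 0$ and let $t$ be a filtration value. For every $u\in\mathcal D_t^{(q)}$ and $v\in\mathcal S_t^{(q)}$, the transition coefficient $w_{uv}$ satisfies $$w_{uv}=\bigl\langle\alpha_v^t,(i_t)_*[z_u]_{t^-}\bigr\rangle_t=\bigl\langle i_t^*\alpha_v^t,[z_u]_{t^-}\bigr\rangle_{t^-}.$$
   Context: $K$ is a finite CW complex with fixed cell orientations and set of open cells $\mathcal K$; $\Bbbk$ is a field. $C_q$, $\partial_q$, $H_q$, $H^q$ denote cellular chains, boundary, homology and cohomology with coefficients in $\Bbbk$. A filtration function $f:\mathcal K\to\mathbb R$ is fixed, i.e. $\tau\subseteq\overline\sigma$ implies $f(\tau)\le f(\sigma)$; its values are called filtration values. $K_t$ (resp. $K_{t^-}$) is the union of the cells $\sigma$ with $f(\sigma)\le t$ (resp. $f(\sigma)<t$), and $i_t:K_{t^-}\hookrightarrow K_t$ is the inclusion, inducing $(i_t)_*$ on homology and $i_t^*$ on cohomology. The cells are totally ordered $\sigma_1\prec\dots\prec\sigma_N$ so that $f(\sigma_i)<f(\sigma_j)$ implies $i<j$, and $\sigma_i\subseteq\overline{\sigma_j}$, $\sigma_i\ne\sigma_j$ implies $i<j$. The sets $K_t$, $K_{t^-}$ and $\bigcup_{\ell\le p}\sigma_\ell$ are CW subcomplexes. The boundary matrix $D\in\Bbbk^{N\times N}$ has entries $D_{ij}=[\sigma_j:\sigma_i]$ (cellular incidence coefficients), so its $j$-th column is the coordinate vector of $\partial\sigma_j$. For a nonzero column $c$, $\operatorname{low}(c)=\max\{i\mid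 c_i\neq 0\}$. A matrix is reduced if no two of its nonzero columns have the same low. Fix a factorization $R=DV$ with $R$ reduced and $V$ upper unitriangular and dimension preserving (column $V_i$ is supported only on cells of the same dimension as $\sigma_i$). Columns are identified with cellular chains. A cell $\sigma_i$ is positive if $R_i=0$; then $z_i:=V_i$ is its selected birth cycle. For positive $\sigma_i$, $\operatorname{pair}(i)=j$ if $\operatorname{low}(R_j)=i$ for some (necessarily unique) $j$ with $R_j\ne0$, and $\operatorname{pair}(i)=\infty$ otherwise. $\mathcal V^{(q)}$ is the set of labeled nonzero $q$-th persistence intervals: each $u\in\mathcal V^{(q)}$ corresponds to a positive $q$-cell with index $i(u)$, with $b_u=f(\sigma_{i(u)})$, $d_u=f(\sigma_{\operatorname{pair}(i(u))})$ if $\operatorname{pair}(i(u))<\infty$ and $d_u=\infty$ otherwise, and only those with $b_u<d_u$ are included. Put $z_u:=z_{i(u)}$. Define $\mathcal D_t^{(q)}=\{u\in\mathcal V^{(q)}\mid b_u<t,\ d_u=t\}$ and $\mathcal S_t^{(q)}=\{v\in\mathcal V^{(q)}\mid b_v<t<d_v\}$. $[\cdot]_t$ and $[\cdot]_{t^-}$ denote classes in $H_q(K_t;\Bbbk)$ and $H_q(K_{t^-};\Bbbk)$. The classes $[z_v]_t$, $v\in\mathcal S_t^{(q)}$, form a basis of $\operatorname{im}(i_t)_*$; the transition coefficients $w_{uv}\in\Bbbk$ are the unique scalars with $(i_t)_*[z_u]_{t^-}=\sum_{v\in\mathcal S_t^{(q)}}w_{uv}[z_v]_t$. The Kronecker pairing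 $\langle[\varphi],[c]\rangle=\varphi(c)$ between $H^q$ and $H_q$ is written $\langle\cdot,\cdot\rangle_t$ on $K_t$ and $\langle\cdot,\cdot\rangle_{t^-}$ on $K_{t^-}$. Extend $\{[z_v]_t\mid v\in\mathcal S_t^{(q)}\}$ to any basis $\mathcal B_t$ of $H_q(K_t;\Bbbk)$ and let $\alpha_v^t\in H^q(K_t;\Bbbk)$ be the element, corresponding to $[z_v]_t$, of the basis of $H^q(K_t;\Bbbk)$ dual to $\mathcal B_t$ under the Kronecker pairing; in particular $\langle\alpha_v^t,[z_r]_t\rangle_t=\delta_{vr}$ for $v,r\in\mathcal S_t^{(q)}$. *)

theory Defs
  imports
    "HOL-Homology.Homology"
    "HOL-Library.Extended_Real"
    "HOL-Library.Disjoint_Sets"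
    "Jordan_Normal_Form.VS_Connect"
begin

section \<open>Finite CW complexes with oriented cells\<close>

text \<open>Points of Euclidean \<open>n\<close>-space are functions \<open>nat \<Rightarrow> real\<close> vanishing from index \<open>n\<close> on, as in
  \<^const>\<open>Euclidean_space\<close> and \<^const>\<open>nsphere\<close>.\<close>

definition sqnorm :: "nat \<Rightarrow> (nat \<Rightarrow> real) \<Rightarrow> real" where
  "sqnorm n y = (\<Sum>i<n. (y i)\<^sup>2)"

definition closed_disc :: "nat \<Rightarrow> (nat \<Rightarrow> real) set" where
  "closed_disc n = {y \<in> topspace (Euclidean_space n). sqnorm n y \<le> 1}"

definition open_disc :: "nat \<Rightarrow> (nat \<Rightarrow> real) set" where
  "open_disc n = {y \<in> topspace (Euclidean_space n). sqnorm n y < 1}"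

definition disc_boundary :: "nat \<Rightarrow> (nat \<Rightarrow> real) set" where
  "disc_boundary n = {y \<in> topspace (Euclidean_space n). sqnorm n y = 1}"

text \<open>Cells are open cells. The orientation of a cell is the standard orientation of the disc,
  transported by the characteristic map and multiplied by the sign \<open>cw_sign\<close>.\<close>

record 'a cw_complex =
  cw_space :: "'a topology"
  cells :: "'a set set"
  cdim :: "'a set \<Rightarrow> nat"
  charmap :: "'a set \<Rightarrow> (nat \<Rightarrow> real) \<Rightarrow> 'a"
  cw_sign :: "'a set \<Rightarrow> int"

text \<open>Closure finiteness and the weak topology are automatic for finitely many cells in a
  Hausdorff space.\<close>

locale finite_cw_complex =
  fixes K :: "'a cw_complex"
  assumes hausdorff: "Hausdorff_space (cw_space K)"
    and finite_cells: "finite (cells K)"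
    and disjoint_cells: "disjoint (cells K)"
    and cells_cover: "\<Union>(cells K) = topspace (cw_space K)"
    and charmap_continuous: "\<And>\<sigma>. \<sigma> \<in> cells K \<Longrightarrow>
      continuous_map (subtopology (Euclidean_space (cdim K \<sigma>)) (closed_disc (cdim K \<sigma>)))
        (cw_space K) (charmap K \<sigma>)"
    and charmap_interior: "\<And>\<sigma>. \<sigma> \<in> cells K \<Longrightarrow>
      homeomorphic_map (subtopology (Euclidean_space (cdim K \<sigma>)) (open_disc (cdim K \<sigma>)))
        (subtopology (cw_space K) \<sigma>) (charmap K \<sigma>)"
    and charmap_boundary: "\<And>\<sigma>. \<sigma> \<in> cells K \<Longrightarrow>
      charmap K \<sigma> ` disc_boundary (cdim K \<sigma>) \<subseteq> \<Union>{\<tau> \<in> cells K. cdim K \<tau> < cdim K \<sigma>}"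
    and cw_sign: "\<And>\<sigma>. \<sigma> \<in> cells K \<Longrightarrow> cw_sign K \<sigma> \<in> {1, -1}"

definition cw_subcomplex :: "'a cw_complex \<Rightarrow> 'a set \<Rightarrow> bool" where
  "cw_subcomplex K A \<longleftrightarrow> closedin (cw_space K) A \<and> (\<exists>S \<subseteq> cells K. A = \<Union>S)"

text \<open>\<open>pinch q\<close> induces a homeomorphism from the disc modulo its boundary to the \<open>q\<close>-sphere, sending
  the boundary to \<open>pinch_base\<close>. It has degree \<open>1\<close> for the standard orientation of the disc and
  the orientation of the sphere as boundary of the \<open>(q+1)\<close>-disc: at the image \<open>(1,0,\<dots>,0)\<close> of
  the centre the outward normal is the first coordinate direction, followed by the images of the
  coordinate directions of the disc in order.\<close>

definition pinch :: "nat \<Rightarrow> (nat \<Rightarrow> real) \<Rightarrow> (nat \<Rightarrow> real)" where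
  "pinch q y = (\<lambda>i. case i of 0 \<Rightarrow> 1 - 2 * sqnorm q y
                            | Suc j \<Rightarrow> 2 * sqrt (1 - sqnorm q y) * y j)"

definition pinch_base :: "nat \<Rightarrow> real" where
  "pinch_base = (\<lambda>i. if i = 0 then -1 else 0)"

text \<open>The projection of the \<open>q\<close>-skeleton onto its quotient by the complement of the \<open>q\<close>-cell \<open>\<tau>\<close>,
  this quotient being identified with the \<open>q\<close>-sphere.\<close>

definition collapse :: "'a cw_complex \<Rightarrow> 'a set \<Rightarrow> 'a \<Rightarrow> (nat \<Rightarrow> real)" where
  "collapse K \<tau> x =
     (if x \<in> \<tau> then pinch (cdim K \<tau>) (inv_into (open_disc (cdim K \<tau>)) (charmap K \<tau>) x)
      else pinch_base)"

text \<open>The incidence coefficient \<open>[\<sigma>:\<tau>]\<close>. \<^const>\<open>Brouwer_degree2\<close> is the degree on reduced homology,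
  so the case of an edge \<open>\<sigma>\<close> and a vertex \<open>\<tau>\<close> is covered: the end of \<open>\<sigma>\<close> at \<open>1\<close> counts
  positively, the one at \<open>-1\<close> negatively.\<close>

definition incidence :: "'a cw_complex \<Rightarrow> 'a set \<Rightarrow> 'a set \<Rightarrow> int" where
  "incidence K \<sigma> \<tau> =
     (if cdim K \<sigma> = Suc (cdim K \<tau>)
      then cw_sign K \<sigma> * cw_sign K \<tau> *
           Brouwer_degree2 (cdim K \<tau>) (collapse K \<tau> \<circ> charmap K \<sigma>)
      else 0)"


section \<open>Cellular homology and cohomology over a field\<close>

text \<open>Chains and cochains of a subcomplex \<open>A\<close> are functions on the cells of \<open>K\<close> that vanish off the
  \<open>q\<close>-cells of \<open>A\<close>; a cochain is the linear functional on chains determined by its values on cells.\<close>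

type_synonym ('a, 'k) chain = "'a set \<Rightarrow> 'k"

definition cells_in :: "'a cw_complex \<Rightarrow> 'a set \<Rightarrow> nat \<Rightarrow> 'a set set" where
  "cells_in K A q = {\<sigma> \<in> cells K. \<sigma> \<subseteq> A \<and> cdim K \<sigma> = q}"

definition chains :: "'a cw_complex \<Rightarrow> 'a set \<Rightarrow> nat \<Rightarrow> ('a, 'k::field) chain set" where
  "chains K A q = {c. \<forall>\<sigma>. \<sigma> \<notin> cells_in K A q \<longrightarrow> c \<sigma> = 0}"

definition boundary :: "'a cw_complex \<Rightarrow> ('a, 'k::field) chain \<Rightarrow> ('a, 'k) chain" where
  "boundary K c =
     (\<lambda>\<tau>. if \<tau> \<in> cells K then \<Sum>\<sigma>\<in>cells K. of_int (incidence K \<sigma> \<tau>) * c \<sigma> else 0)"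

definition cycles :: "'a cw_complex \<Rightarrow> 'a set \<Rightarrow> nat \<Rightarrow> ('a, 'k::field) chain set" where
  "cycles K A q = {c \<in> chains K A q. boundary K c = (\<lambda>_. 0)}"

definition boundaries :: "'a cw_complex \<Rightarrow> 'a set \<Rightarrow> nat \<Rightarrow> ('a, 'k::field) chain set" where
  "boundaries K A q = boundary K ` chains K A (Suc q)"

definition cochain_eval ::
    "'a cw_complex \<Rightarrow> 'a set \<Rightarrow> nat \<Rightarrow> ('a, 'k::field) chain \<Rightarrow> ('a, 'k) chain \<Rightarrow> 'k" where
  "cochain_eval K A q \<phi> c = (\<Sum>\<sigma>\<in>cells_in K A q. \<phi> \<sigma> * c \<sigma>)"

text \<open>\<open>(\<delta>\<phi>)(\<sigma>) = \<phi>(\<partial>\<sigma>)\<close>.\<close>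

definition coboundary ::
    "'a cw_complex \<Rightarrow> 'a set \<Rightarrow> nat \<Rightarrow> ('a, 'k::field) chain \<Rightarrow> ('a, 'k) chain" where
  "coboundary K A q \<phi> =
     (\<lambda>\<sigma>. if \<sigma> \<in> cells_in K A (Suc q)
          then cochain_eval K A q \<phi> (boundary K (\<lambda>\<tau>. if \<tau> = \<sigma> then 1 else 0)) else 0)"

definition cocycles :: "'a cw_complex \<Rightarrow> 'a set \<Rightarrow> nat \<Rightarrow> ('a, 'k::field) chain set" where
  "cocycles K A q = {\<phi> \<in> chains K A q. coboundary K A q \<phi> = (\<lambda>_. 0)}"

definition coboundaries :: "'a cw_complex \<Rightarrow> 'a set \<Rightarrow> nat \<Rightarrow> ('a, 'k::field) chain set" where
  "coboundaries K A q =
     (case q of 0 \<Rightarrow> {\<lambda>_. 0} | Suc p \<Rightarrow> coboundary K A p ` chains K A p)"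

definition fun_module :: "('i \<Rightarrow> 'k::field) set \<Rightarrow> ('k, 'i \<Rightarrow> 'k) module" where
  "fun_module Z = \<lparr>carrier = Z, mult = undefined, one = undefined, zero = (\<lambda>_. 0),
     add = (\<lambda>c d i. c i + d i), smult = (\<lambda>a c i. a * c i)\<rparr>"

definition quotient_module :: "('k, 'm) module \<Rightarrow> 'm set \<Rightarrow> ('k, 'm set) module" where
  "quotient_module M B = \<lparr>carrier = a_rcosets\<^bsub>M\<^esub> B, mult = undefined, one = undefined, zero = B,
     add = set_add M, smult = (\<lambda>a X. \<Union>x\<in>X. B +>\<^bsub>M\<^esub> (a \<odot>\<^bsub>M\<^esub> x))\<rparr>"

definition homology ::
    "'a cw_complex \<Rightarrow> 'a set \<Rightarrow> nat \<Rightarrow> ('k::field, ('a, 'k) chain set) module" where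
  "homology K A q = quotient_module (fun_module (cycles K A q)) (boundaries K A q)"

definition cohomology ::
    "'a cw_complex \<Rightarrow> 'a set \<Rightarrow> nat \<Rightarrow> ('k::field, ('a, 'k) chain set) module" where
  "cohomology K A q = quotient_module (fun_module (cocycles K A q)) (coboundaries K A q)"

definition hom_class ::
    "'a cw_complex \<Rightarrow> 'a set \<Rightarrow> nat \<Rightarrow> ('a, 'k::field) chain \<Rightarrow> ('a, 'k) chain set" where
  "hom_class K A q c = boundaries K A q +>\<^bsub>fun_module (cycles K A q)\<^esub> c"

definition cohom_class ::
    "'a cw_complex \<Rightarrow> 'a set \<Rightarrow> nat \<Rightarrow> ('a, 'k::field) chain \<Rightarrow> ('a, 'k) chain set" where
  "cohom_class K A q \<phi> = coboundaries K A q +>\<^bsub>fun_module (cocycles K A q)\<^esub> \<phi>"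

text \<open>The maps induced by the inclusion of a subcomplex \<open>A\<close> into a subcomplex \<open>A'\<close>. The unions run
  over all representatives of the class and are single cosets, since all representatives
  give the same class.\<close>

definition incl_homology ::
    "'a cw_complex \<Rightarrow> 'a set \<Rightarrow> nat \<Rightarrow> ('a, 'k::field) chain set \<Rightarrow> ('a, 'k) chain set" where
  "incl_homology K A' q X = (\<Union>c\<in>X. hom_class K A' q c)"

definition incl_cohomology ::
    "'a cw_complex \<Rightarrow> 'a set \<Rightarrow> nat \<Rightarrow> ('a, 'k::field) chain set \<Rightarrow> ('a, 'k) chain set" where
  "incl_cohomology K A q X =
     (\<Union>\<phi>\<in>X. cohom_class K A q (\<lambda>\<sigma>. if \<sigma> \<in> cells_in K A q then \<phi> \<sigma> else 0))"

definition kronecker ::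
    "'a cw_complex \<Rightarrow> 'a set \<Rightarrow> nat \<Rightarrow> ('a, 'k::field) chain set \<Rightarrow> ('a, 'k) chain set \<Rightarrow> 'k" where
  "kronecker K A q X Y = (THE a. \<forall>\<phi>\<in>X. \<forall>c\<in>Y. cochain_eval K A q \<phi> c = a)"

definition homology_basis ::
    "'a cw_complex \<Rightarrow> 'a set \<Rightarrow> nat \<Rightarrow> ('a, 'k::field) chain set set \<Rightarrow> bool" where
  "homology_basis K A q \<B> \<longleftrightarrow> vectorspace.basis class_ring (homology K A q) \<B>"

text \<open>\<open>\<alpha>\<close> sends each element of the basis \<open>\<B>\<close> of homology to the corresponding element of the dual
  basis of cohomology.\<close>

definition dual_basis ::
    "'a cw_complex \<Rightarrow> 'a set \<Rightarrow> nat \<Rightarrow> ('a, 'k::field) chain set set \<Rightarrow>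
     (('a, 'k) chain set \<Rightarrow> ('a, 'k) chain set) \<Rightarrow> bool" where
  "dual_basis K A q \<B> \<alpha> \<longleftrightarrow>
     vectorspace.basis class_ring (cohomology K A q) (\<alpha> ` \<B>) \<and>
     (\<forall>X\<in>\<B>. \<forall>Y\<in>\<B>. kronecker K A q (\<alpha> X) Y = (if X = Y then 1 else 0))"


section \<open>Filtrations\<close>

definition sublevel :: "'a cw_complex \<Rightarrow> ('a set \<Rightarrow> real) \<Rightarrow> real \<Rightarrow> 'a set" where
  "sublevel K f t = \<Union>{\<sigma> \<in> cells K. f \<sigma> \<le> t}"

definition strict_sublevel :: "'a cw_complex \<Rightarrow> ('a set \<Rightarrow> real) \<Rightarrow> real \<Rightarrow> 'a set" where
  "strict_sublevel K f t = \<Union>{\<sigma> \<in> cells K. f \<sigma> < t}"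

text \<open>The cells are enumerated from \<open>0\<close>. The subcomplex assumptions are not redundant: the closure of
  a cell of a general CW complex may meet another cell without containing it.\<close>

locale filtered_cw_complex = finite_cw_complex K
  for K :: "'a cw_complex" +
  fixes f :: "'a set \<Rightarrow> real" and cell :: "nat \<Rightarrow> 'a set"
  assumes filtration: "\<And>\<sigma> \<tau>. \<lbrakk>\<sigma> \<in> cells K; \<tau> \<in> cells K; \<tau> \<subseteq> cw_space K closure_of \<sigma>\<rbrakk> \<Longrightarrow> f \<tau> \<le> f \<sigma>"
    and enumeration: "bij_betw cell {..<card (cells K)} (cells K)"
    and order_filtration: "\<And>i j. \<lbrakk>i < card (cells K); j < card (cells K); f (cell i) < f (cell j)\<rbrakk>
      \<Longrightarrow> i < j"
    and order_faces: "\<And>i j. \<lbrakk>i < card (cells K); j < card (cells K);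
      cell i \<subseteq> cw_space K closure_of cell j; cell i \<noteq> cell j\<rbrakk> \<Longrightarrow> i < j"
    and sublevel_subcomplex: "\<And>t. cw_subcomplex K (sublevel K f t)"
    and strict_sublevel_subcomplex: "\<And>t. cw_subcomplex K (strict_sublevel K f t)"
    and initial_subcomplex: "\<And>p. p < card (cells K) \<Longrightarrow> cw_subcomplex K (\<Union>l\<le>p. cell l)"


section \<open>Matrix reduction and persistence intervals\<close>

definition boundary_matrix :: "'a cw_complex \<Rightarrow> (nat \<Rightarrow> 'a set) \<Rightarrow> 'k::field mat" where
  "boundary_matrix K cell =
     mat (card (cells K)) (card (cells K)) (\<lambda>(i, j). of_int (incidence K (cell j) (cell i)))"

definition low :: "'k::zero vec \<Rightarrow> nat" where
  "low c = Max {i. i < dim_vec c \<and> c $ i \<noteq> 0}"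

definition zero_col :: "'k::zero mat \<Rightarrow> nat \<Rightarrow> bool" where
  "zero_col R j \<longleftrightarrow> col R j = 0\<^sub>v (dim_row R)"

definition reduced :: "'k::zero mat \<Rightarrow> bool" where
  "reduced R \<longleftrightarrow> (\<forall>i<dim_col R. \<forall>j<dim_col R.
     \<not> zero_col R i \<and> \<not> zero_col R j \<and> low (col R i) = low (col R j) \<longrightarrow> i = j)"

definition reduction ::
    "'a cw_complex \<Rightarrow> (nat \<Rightarrow> 'a set) \<Rightarrow> 'k::field mat \<Rightarrow> 'k mat \<Rightarrow> bool" where
  "reduction K cell R V \<longleftrightarrow>
     V \<in> carrier_mat (card (cells K)) (card (cells K)) \<and>
     R = boundary_matrix K cell * V \<and>
     reduced R \<and>
     upper_triangular V \<and> (\<forall>i<card (cells K). V $$ (i, i) = 1) \<and>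
     (\<forall>i<card (cells K). \<forall>j<card (cells K).
        V $$ (j, i) \<noteq> 0 \<longrightarrow> cdim K (cell j) = cdim K (cell i))"

definition chain_of_vec :: "(nat \<Rightarrow> 'a set) \<Rightarrow> 'k::field vec \<Rightarrow> ('a, 'k) chain" where
  "chain_of_vec cell c = (\<lambda>\<sigma>. \<Sum>i<dim_vec c. if cell i = \<sigma> then c $ i else 0)"

definition birth_cycle :: "(nat \<Rightarrow> 'a set) \<Rightarrow> 'k::field mat \<Rightarrow> nat \<Rightarrow> ('a, 'k) chain" where
  "birth_cycle cell V i = chain_of_vec cell (col V i)"

text \<open>\<^const>\<open>None\<close> stands for the value \<open>\<infinity>\<close>.\<close>

definition pair :: "'k::field mat \<Rightarrow> nat \<Rightarrow> nat option" where
  "pair R i =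
     (if \<exists>j<dim_col R. \<not> zero_col R j \<and> low (col R j) = i
      then Some (THE j. j < dim_col R \<and> \<not> zero_col R j \<and> low (col R j) = i)
      else None)"

definition birth :: "('a set \<Rightarrow> real) \<Rightarrow> (nat \<Rightarrow> 'a set) \<Rightarrow> nat \<Rightarrow> ereal" where
  "birth f cell i = ereal (f (cell i))"

definition death :: "('a set \<Rightarrow> real) \<Rightarrow> (nat \<Rightarrow> 'a set) \<Rightarrow> 'k::field mat \<Rightarrow> nat \<Rightarrow> ereal" where
  "death f cell R i = (case pair R i of None \<Rightarrow> \<infinity> | Some j \<Rightarrow> ereal (f (cell j)))"

text \<open>A labeled interval is represented by the index of its positive cell.\<close>

definition intervals ::
    "'a cw_complex \<Rightarrow> ('a set \<Rightarrow> real) \<Rightarrow> (nat \<Rightarrow> 'a set) \<Rightarrow> 'k::field mat \<Rightarrow> nat \<Rightarrow> nat set" where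
  "intervals K f cell R q =
     {i. i < card (cells K) \<and> cdim K (cell i) = q \<and> zero_col R i \<and>
         birth f cell i < death f cell R i}"

definition dying ::
    "'a cw_complex \<Rightarrow> ('a set \<Rightarrow> real) \<Rightarrow> (nat \<Rightarrow> 'a set) \<Rightarrow> 'k::field mat \<Rightarrow> nat \<Rightarrow> real \<Rightarrow> nat set" where
  "dying K f cell R q t =
     {u \<in> intervals K f cell R q. birth f cell u < ereal t \<and> death f cell R u = ereal t}"

definition surviving ::
    "'a cw_complex \<Rightarrow> ('a set \<Rightarrow> real) \<Rightarrow> (nat \<Rightarrow> 'a set) \<Rightarrow> 'k::field mat \<Rightarrow> nat \<Rightarrow> real \<Rightarrow> nat set" where
  "surviving K f cell R q t =
     {v \<in> intervals K f cell R q. birth f cell v < ereal t \<and> ereal t < death f cell R v}"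

text \<open>The equations determine \<open>w u v\<close> for dying \<open>u\<close> and surviving \<open>v\<close>, because the classes of the
  surviving birth cycles are linearly independent.\<close>

definition transition_coefficients ::
    "'a cw_complex \<Rightarrow> ('a set \<Rightarrow> real) \<Rightarrow> (nat \<Rightarrow> 'a set) \<Rightarrow> 'k::field mat \<Rightarrow> 'k mat \<Rightarrow> nat \<Rightarrow> real \<Rightarrow>
     (nat \<Rightarrow> nat \<Rightarrow> 'k) \<Rightarrow> bool" where
  "transition_coefficients K f cell R V q t w \<longleftrightarrow>
     (\<forall>u\<in>dying K f cell R q t.
        incl_homology K (sublevel K f t) q
          (hom_class K (strict_sublevel K f t) q (birth_cycle cell V u)) =
        finsum (homology K (sublevel K f t) q)
          (\<lambda>v. w u v \<odot>\<^bsub>homology K (sublevel K f t) q\<^esub>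
               hom_class K (sublevel K f t) q (birth_cycle cell V v))
          (surviving K f cell R q t))"

end

theory Submission
  imports Defs
begin

text \<open>The value of \<^const>\<open>kronecker\<close> is meaningful only if cochain evaluation does not depend on the
  representatives, and for sums of a coboundary and a cocycle on sums of a boundary and a cycle this
  amounts to \<open>\<partial>\<partial> = 0\<close> for incidence numbers defined as Brouwer degrees. For \<open>\<partial>\<partial> = 0\<close>, attaching cells
  one at a time shows (by excision and a radial deformation of the disc) that the singular group
  \<open>H\<^sub>n(X\<^sup>n, X\<^sup>n\<^sup>-\<^sup>1)\<close> is generated by the images of \<open>H\<^sub>n(D\<^sup>n, S\<^sup>n\<^sup>-\<^sup>1)\<close> under the characteristic maps. On
  these generators one can compare the degrees with the connecting homomorphism, which kills the class
  of an attaching map \<open>S\<^sup>n \<longrightarrow> X\<^sup>n\<close>. Given this, pairing the defining equation of the transition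
  coefficients with \<open>\<alpha>\<^sub>v\<close> leaves \<open>w\<^sub>u\<^sub>v\<close>, provided that distinct surviving cells have distinct classes. If
  two agreed, the difference of the birth cycles would be a boundary in \<open>K\<^sub>t\<close>, hence a combination of
  columns of \<open>R\<close> with index in \<open>K\<^sub>t\<close>; as \<open>R\<close> is reduced, its low, which is the larger of the two
  indices, is the low of one of these columns, so this index is paired within \<open>K\<^sub>t\<close>.\<close>

section \<open>Discs and spheres\<close>

lemma continuous_map_closed_cover:
  assumes A: "closedin X A" and g: "continuous_map (subtopology X A) Z g"
    and F: "closed_map Y X F" and gF: "continuous_map Y Z (g \<circ> F)"
    and cover: "topspace X = A \<union> F ` topspace Y"
  shows "continuous_map X Z g"
  unfolding continuous_map_closedin
proof (intro conjI allI impI)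
  show "g \<in> topspace X \<rightarrow> topspace Z"
    using closedin_subset[OF A] continuous_map_funspace[OF g] continuous_map_funspace[OF gF]
    unfolding cover by (auto simp: Pi_iff topspace_subtopology cover)
next
  fix C assume C: "closedin Z C"
  have 1: "closedin X {x \<in> topspace (subtopology X A). g x \<in> C}"
    using closedin_continuous_map_preimage[OF g C] A closedin_trans_full by blast
  have 2: "closedin X (F ` {y \<in> topspace Y. (g \<circ> F) y \<in> C})"
    using closedin_continuous_map_preimage[OF gF C] F unfolding closed_map_def by blast
  have "{x \<in> topspace X. g x \<in> C} = {x \<in> topspace (subtopology X A). g x \<in> C}
          \<union> F ` {y \<in> topspace Y. (g \<circ> F) y \<in> C}"
    using cover by auto
  then show "closedin X {x \<in> topspace X. g x \<in> C}"
    using closedin_Un[OF 1 2] by simp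
qed

abbreviation disc :: "nat \<Rightarrow> (nat \<Rightarrow> real) topology" where
  "disc n \<equiv> subtopology (Euclidean_space n) (closed_disc n)"

lemma closed_disc_subset: "closed_disc n \<subseteq> topspace (Euclidean_space n)"
  by (auto simp: closed_disc_def)

lemma topspace_disc: "topspace (disc n) = closed_disc n"
  using closed_disc_subset by (simp add: topspace_subtopology inf.absorb2)

lemma open_disc_subset: "open_disc n \<subseteq> closed_disc n"
  by (auto simp: open_disc_def closed_disc_def)

lemma disc_boundary_subset: "disc_boundary n \<subseteq> closed_disc n"
  by (auto simp: disc_boundary_def closed_disc_def)

lemma closed_disc_eq: "closed_disc n = open_disc n \<union> disc_boundary n"
  by (auto simp: open_disc_def closed_disc_def disc_boundary_def)

lemma continuous_map_into_Euclidean_subspace: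
  assumes "S \<subseteq> topspace (Euclidean_space n)"
  shows "continuous_map X (subtopology (Euclidean_space n) S) g \<longleftrightarrow>
    (\<forall>i. continuous_map X euclideanreal (\<lambda>x. g x i)) \<and> g \<in> topspace X \<rightarrow> S"
  using assms
  unfolding continuous_map_in_subtopology Euclidean_space_def continuous_map_componentwise_UNIV
  by (auto simp: Pi_iff)

lemma continuous_map_Euclidean_coordinate:
  "continuous_map (Euclidean_space n) euclideanreal (\<lambda>x. x i)"
  unfolding Euclidean_space_def
  by (intro continuous_map_from_subtopology continuous_map_product_projection) simp

lemma continuous_map_disc_coordinate: "continuous_map (disc n) euclideanreal (\<lambda>x. x i)"
  by (intro continuous_map_from_subtopology continuous_map_Euclidean_coordinate)

lemma continuous_map_sqnorm:
  assumes "\<And>i. i < n \<Longrightarrow> continuous_map X euclideanreal (\<lambda>x. g x i)"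
  shows "continuous_map X euclideanreal (\<lambda>x. sqnorm n (g x))"
  unfolding sqnorm_def by (intro continuous_intros assms) auto

lemma sqnorm_nonneg: "0 \<le> sqnorm n y"
  by (simp add: sqnorm_def sum_nonneg)

lemma sqnorm_scale: "sqnorm n (\<lambda>i. c * y i) = c\<^sup>2 * sqnorm n y"
  by (simp add: sqnorm_def power_mult_distrib sum_distrib_left)

lemma closed_disc_coordinate_le:
  assumes "y \<in> closed_disc n" shows "\<bar>y i\<bar> \<le> 1"
proof (cases "i < n")
  case True
  then have "(y i)\<^sup>2 \<le> sqnorm n y"
    unfolding sqnorm_def by (intro member_le_sum) auto
  then have "(y i)\<^sup>2 \<le> 1" using assms by (simp add: closed_disc_def)
  then show ?thesis by (simp add: abs_square_le_1)
next
  case False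
  then show ?thesis using assms by (simp add: closed_disc_def topspace_Euclidean_space)
qed

lemma closedin_closed_disc: "closedin (Euclidean_space n) (closed_disc n)"
proof -
  have "continuous_map (Euclidean_space n) euclideanreal (sqnorm n)"
    by (rule continuous_map_sqnorm[where g = "\<lambda>x. x"]) (rule continuous_map_Euclidean_coordinate)
  from closedin_continuous_map_preimage[OF this, of "{..1}"]
  show ?thesis by (simp add: closed_disc_def)
qed

lemma compact_space_disc: "compact_space (disc n)"
proof -
  have "compactin (powertop_real UNIV) (Pi\<^sub>E UNIV (\<lambda>i. {-1..1::real}))"
    by (subst compactin_PiE) auto
  moreover have "closedin (powertop_real UNIV) (closed_disc n)"
    using closedin_closed_disc[of n] closedin_Euclidean_space[of n]
    by (metis Euclidean_space_def closedin_trans_full topspace_Euclidean_space)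
  moreover have "closed_disc n \<subseteq> Pi\<^sub>E UNIV (\<lambda>i. {-1..1::real})"
    using closed_disc_coordinate_le[of _ n] by (auto simp: abs_le_iff minus_le_iff)
  ultimately have "compactin (powertop_real UNIV) (closed_disc n)"
    by (metis closed_compactin)
  then show ?thesis
    using closed_disc_subset[of n]
    by (metis Euclidean_space_def compact_space_subtopology compactin_subtopology topspace_Euclidean_space)
qed

lemma scaled_in_closed_disc:
  assumes "y \<in> closed_disc n" "\<bar>c\<bar> \<le> 1" shows "(\<lambda>i. c * y i) \<in> closed_disc n"
proof -
  have "c\<^sup>2 * sqnorm n y \<le> 1 * 1"
    using assms by (intro mult_mono) (auto simp: abs_square_le_1 closed_disc_def sqnorm_nonneg)
  then show ?thesis
    using assms by (auto simp: closed_disc_def sqnorm_scale topspace_Euclidean_space)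
qed

lemma contractible_space_disc: "contractible_space (disc n)"
proof -
  let ?h = "\<lambda>z::real \<times> (nat \<Rightarrow> real). \<lambda>i. (1 - fst z) * snd z i"
  have "continuous_map (prod_topology (top_of_set {0..1}) (disc n)) (disc n) ?h"
  proof (subst continuous_map_into_Euclidean_subspace[OF closed_disc_subset], intro conjI allI)
    have c: "continuous_map (prod_topology (top_of_set {0..1::real}) (disc n)) euclideanreal (\<lambda>z. snd z i)" for i
      using continuous_map_compose[OF continuous_map_snd continuous_map_disc_coordinate] by (simp add: o_def)
    have "continuous_map (prod_topology (top_of_set {0..1::real}) (disc n)) euclideanreal fst"
      using continuous_map_fst continuous_map_into_fulltopology by blast
    then show "continuous_map (prod_topology (top_of_set {0..1}) (disc n)) euclideanreal (\<lambda>z. ?h z i)" for i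
      by (intro continuous_intros c)
    show "?h \<in> topspace (prod_topology (top_of_set {0..1}) (disc n)) \<rightarrow> closed_disc n"
      by (auto simp: topspace_disc intro!: scaled_in_closed_disc)
  qed
  then show ?thesis
    unfolding contractible_space_def homotopic_with_def
    by (intro exI[of _ "\<lambda>_. 0"] exI[of _ ?h]) auto
qed

lemma subtopology_disc_boundary: "subtopology (disc (Suc m)) (disc_boundary (Suc m)) = nsphere m"
proof -
  have "closed_disc (Suc m) \<inter> disc_boundary (Suc m)
      = topspace (Euclidean_space (Suc m)) \<inter> {x. (\<Sum>i\<le>m. x i ^ 2) = 1}"
    by (auto simp: closed_disc_def disc_boundary_def sqnorm_def lessThan_Suc_atMost)
  then show ?thesis
    unfolding nsphere_def subtopology_subtopology by (metis subtopology_restrict)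
qed

lemma disc_boundary_nonempty: "disc_boundary (Suc m) \<noteq> {}"
  using in_topspace_nsphere[of m] subtopology_disc_boundary[of m]
  by (metis empty_iff topspace_subtopology Int_empty_right)

lemma topspace_nsphere: "topspace (nsphere m) = disc_boundary (Suc m)"
  using disc_boundary_subset[of "Suc m"] topspace_disc[of "Suc m"]
  unfolding subtopology_disc_boundary[symmetric] topspace_subtopology by blast

lemma pinch_boundary: "y \<in> disc_boundary n \<Longrightarrow> pinch n y = pinch_base"
  by (auto simp: pinch_def pinch_base_def disc_boundary_def fun_eq_iff split: nat.split)

lemma pinch_base_in_nsphere: "pinch_base \<in> topspace (nsphere n)"
  by (auto simp: nsphere pinch_base_def sum.atMost_shift)

lemma continuous_map_pinch: "continuous_map (disc n) (nsphere n) (pinch n)"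
proof -
  have *: "nsphere n = subtopology (Euclidean_space (Suc n)) (topspace (nsphere n))"
    by (metis nsphere_def subtopology_restrict topspace_subtopology)
  have sub: "topspace (nsphere n) \<subseteq> topspace (Euclidean_space (Suc n))"
    by (simp add: nsphere_def)
  show ?thesis
  proof (subst *, subst continuous_map_into_Euclidean_subspace[OF sub], intro conjI allI)
    have s: "continuous_map (disc n) euclideanreal (\<lambda>y. sqnorm n y)"
      by (rule continuous_map_sqnorm) (rule continuous_map_disc_coordinate)
    show "continuous_map (disc n) euclideanreal (\<lambda>x. pinch n x i)" for i
    proof (cases i)
      case 0
      then show ?thesis using s by (simp add: pinch_def) (intro continuous_intros s)
    next
      case (Suc j)
      then show ?thesis by (simp add: pinch_def) (intro continuous_intros s continuous_map_disc_coordinate)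
    qed
    show "pinch n \<in> topspace (disc n) \<rightarrow> topspace (nsphere n)"
    proof
      fix y assume "y \<in> topspace (disc n)"
      then have y: "sqnorm n y \<le> 1" "\<And>j. n \<le> j \<Longrightarrow> y j = 0"
        by (auto simp: topspace_disc closed_disc_def topspace_Euclidean_space)
      have "(\<Sum>i\<le>n. (pinch n y i)\<^sup>2) = (1 - 2 * sqnorm n y)\<^sup>2 + (\<Sum>j<n. (2 * sqrt (1 - sqnorm n y) * y j)\<^sup>2)"
        by (simp add: sum.atMost_shift pinch_def)
      also have "(\<Sum>j<n. (2 * sqrt (1 - sqnorm n y) * y j)\<^sup>2) = 4 * (1 - sqnorm n y) * sqnorm n y"
        using y(1) by (simp add: power_mult_distrib sqnorm_def[of n y] sum_distrib_left[symmetric])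
      also have "(1 - 2 * sqnorm n y)\<^sup>2 + 4 * (1 - sqnorm n y) * sqnorm n y = 1"
        by (simp add: power2_eq_square algebra_simps)
      finally show "pinch n y \<in> topspace (nsphere n)"
        using y(2) by (auto simp: nsphere pinch_def split: nat.split)
    qed
  qed
qed

text \<open>For \<open>s\<close> running from \<open>0\<close> to \<open>1\<close> these maps deform the identity of the disc, relative to the
  boundary, to a map that sends the points of norm at least \<open>1/2\<close> to the boundary.\<close>

definition radial_push :: "nat \<Rightarrow> real \<Rightarrow> (nat \<Rightarrow> real) \<Rightarrow> (nat \<Rightarrow> real)" where
  "radial_push n s y = (\<lambda>i. y i / max (1 - s / 2) (sqrt (sqnorm n y)))"

lemma sqnorm_radial_push:
  assumes "0 \<le> s" "s \<le> 1"
  shows "sqnorm n (radial_push n s y) = sqnorm n y / (max (1 - s / 2) (sqrt (sqnorm n y)))\<^sup>2"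
  by (simp add: radial_push_def sqnorm_def power_divide sum_divide_distrib)

lemma sqrt_sqnorm_radial_push:
  assumes "0 \<le> s" "s \<le> 1"
  shows "sqrt (sqnorm n (radial_push n s y)) = sqrt (sqnorm n y) / max (1 - s / 2) (sqrt (sqnorm n y))"
  using assms by (simp add: sqnorm_radial_push real_sqrt_divide max_def sqnorm_nonneg)

lemma radial_push_in_disc:
  assumes "y \<in> closed_disc n" "0 \<le> s" "s \<le> 1"
  shows "radial_push n s y \<in> closed_disc n"
proof -
  have "sqrt (sqnorm n (radial_push n s y)) \<le> 1"
    unfolding sqrt_sqnorm_radial_push[OF assms(2,3)] using assms by (simp add: divide_le_eq)
  then show ?thesis
    using assms(1) by (simp add: closed_disc_def topspace_Euclidean_space radial_push_def)
qed

lemma radial_push_0: "y \<in> closed_disc n \<Longrightarrow> radial_push n 0 y = y"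
  by (auto simp: radial_push_def closed_disc_def max_def)

lemma radial_push_boundary: "y \<in> disc_boundary n \<Longrightarrow> 0 \<le> s \<Longrightarrow> radial_push n s y = y"
  by (simp add: radial_push_def disc_boundary_def max_def)

lemma radial_push_outer:
  assumes "y \<in> closed_disc n" "sqnorm n y > 1/4"
  shows "radial_push n 1 y \<in> disc_boundary n"
proof -
  have "sqrt (1/4) < sqrt (sqnorm n y)" using assms(2) by (subst real_sqrt_less_iff)
  then have r: "sqrt (sqnorm n y) > 1/2" by (simp add: real_sqrt_divide)
  then have "sqrt (sqnorm n (radial_push n 1 y)) = 1"
    by (subst sqrt_sqnorm_radial_push) (auto simp: max_def)
  then show ?thesis
    using assms(1) by (simp add: closed_disc_def disc_boundary_def topspace_Euclidean_space radial_push_def)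
qed

lemma continuous_map_radial_push:
  "continuous_map (prod_topology (top_of_set {0..1}) (disc n)) (disc n)
     (\<lambda>z. radial_push n (fst z) (snd z))"
proof (subst continuous_map_into_Euclidean_subspace[OF closed_disc_subset], intro conjI allI)
  let ?P = "prod_topology (top_of_set {0..1::real}) (disc n)"
  have c: "continuous_map ?P euclideanreal (\<lambda>z. snd z i)" for i
    using continuous_map_compose[OF continuous_map_snd continuous_map_disc_coordinate] by (simp add: o_def)
  have f: "continuous_map ?P euclideanreal fst"
    using continuous_map_fst continuous_map_into_fulltopology by blast
  have "max (1 - fst z / 2) (sqrt (sqnorm n (snd z))) \<noteq> 0" if "z \<in> topspace ?P" for z
    using that by auto
  then show "continuous_map ?P euclideanreal (\<lambda>z. radial_push n (fst z) (snd z) i)" for i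
    unfolding radial_push_def by (intro continuous_intros continuous_map_sqnorm c f) auto
  show "(\<lambda>z. radial_push n (fst z) (snd z)) \<in> topspace ?P \<rightarrow> closed_disc n"
    by (auto simp: topspace_disc intro!: radial_push_in_disc)
qed

lemma continuous_map_radial_push_at:
  assumes "0 \<le> s" "s \<le> 1" shows "continuous_map (disc n) (disc n) (radial_push n s)"
proof -
  have "continuous_map (disc n) (prod_topology (top_of_set {0..1}) (disc n)) (\<lambda>y. (s, y))"
    using assms by (simp add: continuous_map_pairwise o_def)
  from continuous_map_compose[OF this continuous_map_radial_push]
  show ?thesis by (simp add: o_def)
qed

lemma cell_attachment_homotopy:
  assumes X: "Hausdorff_space X" and A: "closedin X A"
    and \<Phi>: "continuous_map (disc n) X \<Phi>"
    and \<psi>: "homeomorphic_maps (subtopology (Euclidean_space n) (open_disc n))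
               (subtopology X (topspace X - A)) \<Phi> \<psi>"
    and \<Phi>bd: "\<Phi> ` disc_boundary n \<subseteq> A"
  shows "homotopic_with (\<lambda>k. k \<in> A \<rightarrow> A) X X id
    (\<lambda>x. if x \<in> topspace X - A then \<Phi> (radial_push n 1 (\<psi> x)) else x)"
proof -
  define h where "h \<equiv> \<lambda>z. if snd z \<in> topspace X - A then \<Phi> (radial_push n (fst z) (\<psi> (snd z))) else snd z"
  let ?I = "top_of_set {0..1::real}"
  have to: "topspace (subtopology (Euclidean_space n) (open_disc n)) = open_disc n"
    using open_disc_subset closed_disc_subset[of n] by (auto simp: topspace_subtopology)
  have \<psi>\<Phi>: "\<psi> (\<Phi> y) = y" "\<Phi> y \<in> topspace X - A" if "y \<in> open_disc n" for y
    using \<psi> that to by (auto simp: homeomorphic_maps_def continuous_map_in_subtopology Pi_iff)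
  have \<Phi>\<psi>: "\<Phi> (\<psi> x) = x" "\<psi> x \<in> open_disc n" if "x \<in> topspace X - A" for x
    using \<psi> that to by (auto simp: homeomorphic_maps_def continuous_map_in_subtopology Pi_iff)
  have AX: "A \<subseteq> topspace X" using A by (rule closedin_subset)
  have "continuous_map (prod_topology ?I X) X h"
  proof (rule continuous_map_closed_cover)
    show "closedin (prod_topology ?I X) ({0..1} \<times> A)"
      using A by (simp add: closedin_prod_Times_iff)
    show "continuous_map (subtopology (prod_topology ?I X) ({0..1} \<times> A)) X h"
    proof (rule continuous_map_eq)
      show "continuous_map (subtopology (prod_topology ?I X) ({0..1} \<times> A)) X snd"
        by (intro continuous_map_from_subtopology continuous_map_snd)
    qed (auto simp: h_def)
    let ?F = "\<lambda>z. (fst z, \<Phi> (snd z))"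
    have F: "continuous_map (prod_topology ?I (disc n)) (prod_topology ?I X) ?F"
      using continuous_map_compose[OF continuous_map_snd \<Phi>]
      by (simp add: continuous_map_pairwise o_def continuous_map_fst)
    then show "closed_map (prod_topology ?I (disc n)) (prod_topology ?I X) ?F"
      using X by (intro T1_Spaces.continuous_imp_closed_map)
        (auto simp: compact_space_prod_topology Hausdorff_space_prod_topology compact_space_disc
            compact_space_subtopology Hausdorff_space_subtopology)
    show "continuous_map (prod_topology ?I (disc n)) X (h \<circ> ?F)"
    proof (rule continuous_map_eq)
      show "continuous_map (prod_topology ?I (disc n)) X (\<lambda>z. \<Phi> (radial_push n (fst z) (snd z)))"
        using continuous_map_compose[OF continuous_map_radial_push \<Phi>] by (simp add: o_def)
      show "\<Phi> (radial_push n (fst z) (snd z)) = (h \<circ> ?F) z"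
        if "z \<in> topspace (prod_topology ?I (disc n))" for z
      proof (cases "snd z \<in> open_disc n")
        case True
        then show ?thesis using \<psi>\<Phi> by (simp add: h_def)
      next
        case False
        have "snd z \<in> topspace (disc n)" and t: "0 \<le> fst z"
          using that by auto
        then have b: "snd z \<in> disc_boundary n"
          using False closed_disc_eq[of n] unfolding topspace_disc by blast
        then show ?thesis using t \<Phi>bd by (auto simp: h_def radial_push_boundary)
      qed
    qed
    have "\<Phi> ` open_disc n = topspace X - A"
      using \<psi>\<Phi> \<Phi>\<psi> by (force simp: image_iff)
    moreover have "\<Phi> ` open_disc n \<union> A = \<Phi> ` closed_disc n \<union> A"
      using \<Phi>bd by (auto simp: closed_disc_eq)
    ultimately have "topspace X = A \<union> \<Phi> ` closed_disc n" using AX by blast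
    then show "topspace (prod_topology ?I X) = {0..1} \<times> A \<union> ?F ` topspace (prod_topology ?I (disc n))"
      unfolding topspace_prod_topology topspace_disc by (force simp: image_iff)
  qed
  moreover have "h (0, x) = x" for x
    using \<Phi>\<psi>[of x] open_disc_subset[of n] by (auto simp: h_def radial_push_0 subset_iff)
  ultimately show ?thesis
    unfolding homotopic_with_def by (intro exI[of _ h]) (auto simp: h_def)
qed

lemma cell_attachment_epi:
  assumes X: "Hausdorff_space X" and A: "closedin X A"
    and \<Phi>: "continuous_map (disc n) X \<Phi>"
    and \<Phi>int: "homeomorphic_map (subtopology (Euclidean_space n) (open_disc n))
               (subtopology X (topspace X - A)) \<Phi>"
    and \<Phi>bd: "\<Phi> ` disc_boundary n \<subseteq> A"
    and y: "y \<in> carrier (relative_homology_group p X A)"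
  obtains a where "a \<in> carrier (relative_homology_group p (disc n) (disc_boundary n))"
    "y = hom_induced p (disc n) (disc_boundary n) X A \<Phi> a"
proof -
  obtain \<psi> where \<psi>: "homeomorphic_maps (subtopology (Euclidean_space n) (open_disc n))
               (subtopology X (topspace X - A)) \<Phi> \<psi>"
    using \<Phi>int homeomorphic_map_maps by blast
  have to: "topspace (subtopology (Euclidean_space n) (open_disc n)) = open_disc n"
    using open_disc_subset closed_disc_subset[of n] by (auto simp: topspace_subtopology)
  have \<Phi>O: "\<Phi> y \<in> topspace X - A" if "y \<in> open_disc n" for y
    using \<psi> that to by (auto simp: homeomorphic_maps_def continuous_map_in_subtopology Pi_iff)
  have \<Phi>\<psi>: "\<Phi> (\<psi> x) = x" "\<psi> x \<in> open_disc n" if "x \<in> topspace X - A" for x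
    using \<psi> that to by (auto simp: homeomorphic_maps_def continuous_map_in_subtopology Pi_iff)
  have AX: "A \<subseteq> topspace X" using A by (rule closedin_subset)
  define inner where "inner \<equiv> {y \<in> closed_disc n. sqnorm n y \<le> 1/4}"
  define T where "T \<equiv> topspace X - \<Phi> ` inner"
  have inner_open: "inner \<subseteq> open_disc n"
    by (auto simp: inner_def closed_disc_def open_disc_def)
  have "continuous_map (disc n) euclideanreal (sqnorm n)"
    by (rule continuous_map_sqnorm[where g = "\<lambda>x. x"]) (rule continuous_map_disc_coordinate)
  from closedin_continuous_map_preimage[OF this, of "{..1/4}"]
  have "closedin (disc n) inner" unfolding topspace_disc inner_def by simp
  moreover have "closed_map (disc n) X \<Phi>"
    using X \<Phi> compact_space_disc by (intro T1_Spaces.continuous_imp_closed_map)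
  ultimately have T: "openin X T"
    unfolding T_def closed_map_def by (simp add: openin_diff)
  have AT: "A \<subseteq> T" using inner_open \<Phi>O AX unfolding T_def by blast
  have TX: "T \<subseteq> topspace X" by (auto simp: T_def)
  let ?Y = "subtopology X (topspace X - A)"
  \<comment> \<open>After excising \<open>A\<close>, the class of \<open>y\<close> in \<open>H(X, T)\<close> comes from the open cell, and the final map of
    the deformation carries \<open>(X, T)\<close> back to \<open>(X, A)\<close>.\<close>
  have "X closure_of A \<subseteq> X interior_of T"
    using A T AT by (simp add: closure_of_closedin interior_of_openin)
  from homology_excision_axiom[OF this TX, of p]
  have "hom_induced p ?Y (T - A) X T id \<in> iso (relative_homology_group p ?Y (T - A)) (relative_homology_group p X T)"
    by simp
  then have "hom_induced p X A X T id y \<in>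
      hom_induced p ?Y (T - A) X T id ` carrier (relative_homology_group p ?Y (T - A))"
    using hom_induced_carrier[of p X A X T id y] by (auto simp: iso_def bij_betw_def)
  then obtain y' where y': "y' \<in> carrier (relative_homology_group p ?Y (T - A))"
    "hom_induced p ?Y (T - A) X T id y' = hom_induced p X A X T id y"
    by auto
  define g where "g \<equiv> \<lambda>x. if x \<in> topspace X - A then \<Phi> (radial_push n 1 (\<psi> x)) else x"
  have hom: "homotopic_with (\<lambda>k. k \<in> A \<rightarrow> A) X X id g"
    unfolding g_def by (rule cell_attachment_homotopy[OF X A \<Phi> \<psi> \<Phi>bd])
  have g: "continuous_map X X g"
    using homotopic_with_imp_continuous_maps[OF hom] by blast
  have outer: "radial_push n 1 (\<psi> x) \<in> disc_boundary n" if "x \<in> T - A" for x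
  proof -
    have x: "x \<in> topspace X - A" "x \<notin> \<Phi> ` inner" using that by (auto simp: T_def)
    then have "\<psi> x \<notin> inner" using \<Phi>\<psi>(1) by force
    then show ?thesis
      using \<Phi>\<psi>(2)[OF x(1)] open_disc_subset[of n] by (intro radial_push_outer) (auto simp: inner_def)
  qed
  have gT: "g \<in> T \<rightarrow> A"
  proof
    fix x assume "x \<in> T"
    then show "g x \<in> A"
      using outer[of x] \<Phi>bd TX by (cases "x \<in> A") (auto simp: g_def)
  qed
  have "hom_induced p X T X A g (hom_induced p X A X T id y) = hom_induced p X A X A (g \<circ> id) y"
    using AT by (intro hom_induced_compose' g gT) auto
  also have "\<dots> = y"
    using homology_homotopy_axiom[OF hom, of p] hom_induced_id[OF y] by simp
  finally have 1: "hom_induced p X T X A g (hom_induced p X A X T id y) = y" .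
  define k where "k \<equiv> \<lambda>x. radial_push n 1 (\<psi> x)"
  have "continuous_map ?Y (subtopology (Euclidean_space n) (open_disc n)) \<psi>"
    using \<psi> by (simp add: homeomorphic_maps_def)
  then have "continuous_map ?Y (disc n) \<psi>"
    using open_disc_subset[of n] by (auto simp: continuous_map_in_subtopology)
  then have k: "continuous_map ?Y (disc n) k"
    using continuous_map_compose[OF _ continuous_map_radial_push_at[of 1 n]] by (fastforce simp: k_def o_def)
  have "y = hom_induced p X T X A g (hom_induced p ?Y (T - A) X T id y')"
    using 1 y'(2) by simp
  also have "\<dots> = hom_induced p ?Y (T - A) X A (g \<circ> id) y'"
    by (intro hom_induced_compose' g gT continuous_map_from_subtopology continuous_map_id) auto
  also have "\<dots> = hom_induced p ?Y (T - A) X A (\<Phi> \<circ> k) y'"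
    by (subst hom_induced_eq[where f = "g \<circ> id" and g = "\<Phi> \<circ> k"]) (auto simp: g_def k_def)
  also have "\<dots> = hom_induced p (disc n) (disc_boundary n) X A \<Phi> (hom_induced p ?Y (T - A) (disc n) (disc_boundary n) k y')"
    using outer \<Phi>bd by (intro hom_induced_compose'[symmetric] k \<Phi>) (auto simp: k_def)
  finally show thesis
    using that hom_induced_carrier by blast
qed

section \<open>Homology of skeleta\<close>

context finite_cw_complex
begin

text \<open>\<open>skel n\<close> is the skeleton of dimension \<open>n - 1\<close>.\<close>

definition skel :: "nat \<Rightarrow> 'a set" where
  "skel n = \<Union>{\<sigma> \<in> cells K. cdim K \<sigma> < n}"

abbreviation subspace :: "'a set \<Rightarrow> 'a topology" where
  "subspace U \<equiv> subtopology (cw_space K) U"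

lemma cell_subset_space: "\<sigma> \<in> cells K \<Longrightarrow> \<sigma> \<subseteq> topspace (cw_space K)"
  using cells_cover by blast

lemma cells_disjointD: "\<lbrakk>\<sigma> \<in> cells K; \<tau> \<in> cells K; x \<in> \<sigma>; x \<in> \<tau>\<rbrakk> \<Longrightarrow> \<sigma> = \<tau>"
  using disjoint_cells unfolding disjoint_def by blast

lemma charmap_open_disc:
  assumes "\<sigma> \<in> cells K" shows "charmap K \<sigma> ` open_disc (cdim K \<sigma>) = \<sigma>"
proof -
  have "open_disc (cdim K \<sigma>) \<subseteq> topspace (Euclidean_space (cdim K \<sigma>))"
    by (auto simp: open_disc_def)
  then show ?thesis
    using homeomorphic_imp_surjective_map[OF charmap_interior[OF assms]] cell_subset_space[OF assms]
    by (simp add: topspace_subtopology inf.absorb2)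
qed

lemma charmap_inj: "\<sigma> \<in> cells K \<Longrightarrow> inj_on (charmap K \<sigma>) (open_disc (cdim K \<sigma>))"
  using homeomorphic_imp_injective_map[OF charmap_interior, of \<sigma>] open_disc_subset closed_disc_subset
  by (metis inf.absorb2 subset_trans topspace_subtopology)

lemma charmap_boundary_skel:
  "\<sigma> \<in> cells K \<Longrightarrow> charmap K \<sigma> ` disc_boundary (cdim K \<sigma>) \<subseteq> skel (cdim K \<sigma>)"
  using charmap_boundary by (simp add: skel_def)

lemma cell_Int_skel: "\<lbrakk>\<sigma> \<in> cells K; n \<le> cdim K \<sigma>\<rbrakk> \<Longrightarrow> \<sigma> \<inter> skel n = {}"
  unfolding skel_def using cells_disjointD by fastforce

lemma cell_subset_skel: "\<lbrakk>\<sigma> \<in> cells K; cdim K \<sigma> < n\<rbrakk> \<Longrightarrow> \<sigma> \<subseteq> skel n"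
  by (auto simp: skel_def)

lemma skel_mono: "m \<le> n \<Longrightarrow> skel m \<subseteq> skel n"
  by (force simp: skel_def)

lemma skel_subset_space: "skel n \<subseteq> topspace (cw_space K)"
  using cell_subset_space by (auto simp: skel_def)

lemma skel_Suc: "skel (Suc n) = skel n \<union> \<Union>{\<sigma> \<in> cells K. cdim K \<sigma> = n}"
  by (auto simp: skel_def less_Suc_eq)

lemma closedin_charmap_image:
  assumes "\<sigma> \<in> cells K"
  shows "closedin (cw_space K) (charmap K \<sigma> ` closed_disc (cdim K \<sigma>))"
  using compactin_imp_closedin[OF hausdorff]
    image_compactin[OF _ charmap_continuous[OF assms]] compact_space_disc
  by (metis compact_space_def topspace_disc)

lemma closedin_Union_cells:
  assumes S: "S \<subseteq> cells K" and lower: "\<And>\<sigma>. \<sigma> \<in> S \<Longrightarrow> skel (cdim K \<sigma>) \<subseteq> \<Union>S"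
  shows "closedin (cw_space K) (\<Union>S)"
proof -
  have "\<Union>S = (\<Union>\<sigma>\<in>S. charmap K \<sigma> ` closed_disc (cdim K \<sigma>))"
  proof (intro equalityI subsetI)
    fix x assume "x \<in> \<Union>S"
    then obtain \<sigma> where \<sigma>: "\<sigma> \<in> S" "x \<in> \<sigma>" by blast
    then have "x \<in> charmap K \<sigma> ` open_disc (cdim K \<sigma>)" using charmap_open_disc S by blast
    then show "x \<in> (\<Union>\<sigma>\<in>S. charmap K \<sigma> ` closed_disc (cdim K \<sigma>))"
      using \<sigma>(1) open_disc_subset by blast
  next
    fix x assume "x \<in> (\<Union>\<sigma>\<in>S. charmap K \<sigma> ` closed_disc (cdim K \<sigma>))"
    then obtain \<sigma> y where \<sigma>: "\<sigma> \<in> S" "\<sigma> \<in> cells K" "y \<in> closed_disc (cdim K \<sigma>)" "x = charmap K \<sigma> y"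
      using S by blast
    then have "y \<in> open_disc (cdim K \<sigma>) \<or> y \<in> disc_boundary (cdim K \<sigma>)"
      using closed_disc_eq by blast
    then show "x \<in> \<Union>S"
      using \<sigma> charmap_open_disc[OF \<sigma>(2)] charmap_boundary_skel[OF \<sigma>(2)] lower[OF \<sigma>(1)] by blast
  qed
  moreover have "finite S" using S finite_cells finite_subset by blast
  ultimately show ?thesis
    using S closedin_charmap_image by (auto intro!: closedin_Union)
qed

lemma closedin_skel_Union:
  assumes "T \<subseteq> cells K" "\<And>\<tau>. \<tau> \<in> T \<Longrightarrow> cdim K \<tau> = n"
  shows "closedin (cw_space K) (skel n \<union> \<Union>T)"
proof -
  have "closedin (cw_space K) (\<Union>({\<sigma> \<in> cells K. cdim K \<sigma> < n} \<union> T))"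
  proof (rule closedin_Union_cells)
    fix \<sigma> assume "\<sigma> \<in> {\<sigma> \<in> cells K. cdim K \<sigma> < n} \<union> T"
    then have "cdim K \<sigma> \<le> n" using assms(2) by auto
    then show "skel (cdim K \<sigma>) \<subseteq> \<Union>({\<sigma> \<in> cells K. cdim K \<sigma> < n} \<union> T)"
      using skel_mono[of "cdim K \<sigma>" n] by (auto simp: skel_def)
  qed (use assms in auto)
  then show ?thesis by (simp add: skel_def Union_Un_distrib)
qed

lemma charmap_continuous_into:
  assumes "\<sigma> \<in> cells K" "\<sigma> \<subseteq> U" "skel (cdim K \<sigma>) \<subseteq> U"
  shows "continuous_map (disc (cdim K \<sigma>)) (subspace U) (charmap K \<sigma>)"
proof -
  have "charmap K \<sigma> y \<in> U" if "y \<in> closed_disc (cdim K \<sigma>)" for y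
  proof -
    have "y \<in> open_disc (cdim K \<sigma>) \<or> y \<in> disc_boundary (cdim K \<sigma>)"
      using that closed_disc_eq by blast
    then show ?thesis
      using charmap_open_disc[OF assms(1)] charmap_boundary_skel[OF assms(1)] assms(2,3) by blast
  qed
  then show ?thesis
    using charmap_continuous[OF assms(1)]
    by (intro continuous_map_into_subtopology) (auto simp: topspace_disc simp del: topspace_subtopology)
qed

lemma skel_union_homology_induct:
  assumes T: "finite T" "T \<subseteq> {\<tau> \<in> cells K. cdim K \<tau> = n}"
    and one: "P \<one>\<^bsub>relative_homology_group p (subspace (skel (Suc n))) (skel n)\<^esub>"
    and mult: "\<And>x y. \<lbrakk>x \<in> carrier (relative_homology_group p (subspace (skel (Suc n))) (skel n));
        y \<in> carrier (relative_homology_group p (subspace (skel (Suc n))) (skel n)); P x; P y\<rbrakk>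
      \<Longrightarrow> P (x \<otimes>\<^bsub>relative_homology_group p (subspace (skel (Suc n))) (skel n)\<^esub> y)"
    and cell: "\<And>\<tau> a. \<lbrakk>\<tau> \<in> cells K; cdim K \<tau> = n; a \<in> carrier (relative_homology_group p (disc n) (disc_boundary n))\<rbrakk>
      \<Longrightarrow> P (hom_induced p (disc n) (disc_boundary n) (subspace (skel (Suc n))) (skel n) (charmap K \<tau>) a)"
    and y: "y \<in> carrier (relative_homology_group p (subspace (skel n \<union> \<Union>T)) (skel n))"
  shows "P (hom_induced p (subspace (skel n \<union> \<Union>T)) (skel n) (subspace (skel (Suc n))) (skel n) id y)"
  using T y
proof (induction T arbitrary: y)
  case empty
  have "trivial_group (relative_homology_group p (subspace (skel n)) (skel n))"
    using trivial_relative_homology_group_topspace[of p "subspace (skel n)"] skel_subset_space[of n]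
    by (simp add: topspace_subtopology inf.absorb2)
  then have "y = \<one>\<^bsub>relative_homology_group p (subspace (skel n)) (skel n)\<^esub>"
    using empty by (simp add: trivial_group_def)
  then show ?case
    using one hom_one[OF hom_induced_hom, of p "subspace (skel n)" "skel n" "subspace (skel (Suc n))" "skel n" id]
    by (simp only: Union_empty Un_empty_right group_relative_homology_group simp_thms)
next
  case (insert \<tau> T)
  define W where "W \<equiv> skel n \<union> \<Union>(insert \<tau> T)"
  let ?D = "disc n" and ?S = "disc_boundary n" and ?E = "subspace (skel (Suc n))" and ?B = "skel n"
  let ?U = "skel n \<union> \<Union>T"
  let ?X = "subspace (W)"
  let ?G = "relative_homology_group p ?X ?B" and ?H = "relative_homology_group p ?X ?U"
  have \<tau>: "\<tau> \<in> cells K" "cdim K \<tau> = n" and T: "T \<subseteq> cells K" "\<And>\<tau>. \<tau> \<in> T \<Longrightarrow> cdim K \<tau> = n"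
    using insert.prems by auto
  have topX: "topspace ?X = W"
    unfolding W_def using skel_subset_space[of n] cell_subset_space \<tau> T by (auto simp: topspace_subtopology)
  have "\<tau> \<inter> ?U = {}"
    using cells_disjointD[OF \<tau>(1)] T insert.hyps cell_Int_skel[OF \<tau>(1), of n] \<tau>(2) by blast
  then have diff: "topspace ?X - ?U = \<tau>" unfolding topX unfolding W_def by blast
  have XU: "subtopology ?X ?U = subspace ?U"
  proof -
    have "W \<inter> ?U = ?U" unfolding W_def by blast
    then show ?thesis by (simp only: subtopology_subtopology)
  qed
  have X\<tau>: "subtopology ?X \<tau> = subspace \<tau>"
  proof -
    have "W \<inter> \<tau> = \<tau>" unfolding W_def by blast
    then show ?thesis by (simp only: subtopology_subtopology)
  qed
  have subE: "W \<subseteq> skel (Suc n)"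
    unfolding W_def using \<tau> T by (auto simp: skel_Suc)
  have \<Phi>X: "continuous_map ?D ?X (charmap K \<tau>)"
    using charmap_continuous_into[OF \<tau>(1), of W] \<tau>(2) by (auto simp: W_def)
  have \<Phi>bd: "charmap K \<tau> ` ?S \<subseteq> ?B"
    using charmap_boundary_skel[OF \<tau>(1)] \<tau>(2) by simp
  have y: "y \<in> carrier ?G" using insert.prems by (simp add: W_def)
  have "Hausdorff_space ?X" by (rule Hausdorff_space_subtopology[OF hausdorff])
  moreover have "closedin ?X ?U"
    using closedin_skel_Union[of T n] T by (intro closedin_subset_topspace) (auto simp: topX W_def)
  moreover have "homeomorphic_map (subtopology (Euclidean_space n) (open_disc n))
      (subtopology ?X (topspace ?X - ?U)) (charmap K \<tau>)"
    unfolding diff X\<tau> using charmap_interior[OF \<tau>(1)] \<tau>(2) by simp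
  moreover have "charmap K \<tau> ` ?S \<subseteq> ?U" using \<Phi>bd by blast
  ultimately obtain a where a: "a \<in> carrier (relative_homology_group p ?D ?S)"
    "hom_induced p ?X ?B ?X ?U id y = hom_induced p ?D ?S ?X ?U (charmap K \<tau>) a"
    using cell_attachment_epi[OF _ _ \<Phi>X _ _ hom_induced_carrier[of p ?X ?B ?X ?U id y]] by metis
  define e where "e \<equiv> hom_induced p ?D ?S ?X ?B (charmap K \<tau>) a"
  interpret G: comm_group ?G by simp
  interpret h: group_hom ?G ?H "hom_induced p ?X ?B ?X ?U id"
    by (simp add: group_hom_def group_hom_axioms_def hom_induced_hom)
  have e: "e \<in> carrier ?G" by (simp add: e_def hom_induced_carrier)
  have "hom_induced p ?X ?B ?X ?U id e = hom_induced p ?D ?S ?X ?U (id \<circ> charmap K \<tau>) a"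
    unfolding e_def using \<Phi>bd by (intro hom_induced_compose' \<Phi>X) auto
  then have "hom_induced p ?X ?B ?X ?U id e = hom_induced p ?X ?B ?X ?U id y" using a(2) by simp
  then have "y \<otimes>\<^bsub>?G\<^esub> inv\<^bsub>?G\<^esub> e \<in> kernel ?G ?H (hom_induced p ?X ?B ?X ?U id)"
    using y e by (simp add: kernel_def)
  also have "kernel ?G ?H (hom_induced p ?X ?B ?X ?U id)
      = hom_induced p (subspace ?U) ?B ?X ?B id ` carrier (relative_homology_group p (subspace ?U) ?B)"
    using homology_exactness_triple_3[of ?B ?U p ?X] XU by simp
  finally obtain y' where y': "y' \<in> carrier (relative_homology_group p (subspace ?U) ?B)"
    "y \<otimes>\<^bsub>?G\<^esub> inv\<^bsub>?G\<^esub> e = hom_induced p (subspace ?U) ?B ?X ?B id y'" by blast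
  then have ye: "y = hom_induced p (subspace ?U) ?B ?X ?B id y' \<otimes>\<^bsub>?G\<^esub> e"
    using y e by (metis G.inv_closed G.inv_solve_right' G.m_closed)
  let ?j = "hom_induced p ?X ?B ?E ?B id"
  have jcont: "continuous_map ?X ?E id"
    using subE by (auto simp: continuous_map_in_subtopology intro: continuous_map_from_subtopology)
  have "continuous_map (subspace ?U) ?X id"
    by (auto simp: W_def continuous_map_in_subtopology intro: continuous_map_from_subtopology)
  then have 1: "?j (hom_induced p (subspace ?U) ?B ?X ?B id y') = hom_induced p (subspace ?U) ?B ?E ?B (id \<circ> id) y'"
    using jcont by (intro hom_induced_compose') auto
  have 2: "?j e = hom_induced p ?D ?S ?E ?B (id \<circ> charmap K \<tau>) a"
    unfolding e_def using \<Phi>bd by (intro hom_induced_compose' \<Phi>X jcont) auto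
  have "?j y = ?j (hom_induced p (subspace ?U) ?B ?X ?B id y') \<otimes>\<^bsub>relative_homology_group p ?E ?B\<^esub> ?j e"
    unfolding ye by (intro hom_mult[OF hom_induced_hom] hom_induced_carrier e)
  moreover have "P (?j e)" using cell[OF \<tau> a(1)] 2 by simp
  moreover have "P (?j (hom_induced p (subspace ?U) ?B ?X ?B id y'))"
    using insert.IH[OF _ y'(1)] insert.prems 1 by (simp add: id_def o_def)
  ultimately show ?case
    unfolding W_def[symmetric] using mult by (simp add: hom_induced_carrier id_def)
qed

lemma skel_homology_induct [consumes 1, case_names one mult cell]:
  assumes y: "y \<in> carrier (relative_homology_group p (subspace (skel (Suc n))) (skel n))"
    and one: "P \<one>\<^bsub>relative_homology_group p (subspace (skel (Suc n))) (skel n)\<^esub>"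
    and mult: "\<And>x y. \<lbrakk>x \<in> carrier (relative_homology_group p (subspace (skel (Suc n))) (skel n));
        y \<in> carrier (relative_homology_group p (subspace (skel (Suc n))) (skel n)); P x; P y\<rbrakk>
      \<Longrightarrow> P (x \<otimes>\<^bsub>relative_homology_group p (subspace (skel (Suc n))) (skel n)\<^esub> y)"
    and cell: "\<And>\<tau> a. \<lbrakk>\<tau> \<in> cells K; cdim K \<tau> = n; a \<in> carrier (relative_homology_group p (disc n) (disc_boundary n))\<rbrakk>
      \<Longrightarrow> P (hom_induced p (disc n) (disc_boundary n) (subspace (skel (Suc n))) (skel n) (charmap K \<tau>) a)"
  shows "P y"
proof -
  have "P (hom_induced p (subspace (skel (Suc n))) (skel n) (subspace (skel (Suc n))) (skel n) id y)"
    using skel_union_homology_induct[of "{\<tau> \<in> cells K. cdim K \<tau> = n}" n P p y] assms finite_cells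
    by (simp add: skel_Suc[symmetric])
  then show ?thesis using y by (simp add: hom_induced_id)
qed

end

section \<open>The square of the cellular boundary\<close>

lemma nsphere_reduced_generator:
  obtains a where "a \<in> carrier (reduced_homology_group (int n) (nsphere n))"
    "\<And>x. x \<in> carrier (reduced_homology_group (int n) (nsphere n)) \<Longrightarrow>
      \<exists>k::int. x = a [^]\<^bsub>reduced_homology_group (int n) (nsphere n)\<^esub> k"
    "\<And>i j::int. a [^]\<^bsub>reduced_homology_group (int n) (nsphere n)\<^esub> i
      = a [^]\<^bsub>reduced_homology_group (int n) (nsphere n)\<^esub> j \<Longrightarrow> i = j"
proof -
  let ?G = "reduced_homology_group (int n) (nsphere n)"
  interpret group ?G by simp
  obtain a where a: "a \<in> carrier ?G" and aeq: "subgroup_generated ?G {a} = ?G"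
    using cyclic_reduced_homology_group_nsphere [of n n] by (auto simp: cyclic_group_def)
  have ord: "ord a = 0"
    by (simp add: a aeq iso_finite [OF reduced_homology_group_nsphere(1)] flip: infinite_cyclic_subgroup_order)
  show thesis
  proof (rule that[OF a])
    show "\<exists>k::int. x = a [^]\<^bsub>?G\<^esub> k" if "x \<in> carrier ?G" for x
      using carrier_subgroup_generated_by_singleton[OF a] that aeq by auto
    show "i = j" if "a [^]\<^bsub>?G\<^esub> i = a [^]\<^bsub>?G\<^esub> j" for i j :: int
      using that ord by (simp add: int_pow_eq a)
  qed
qed

lemma hom_induced_into_relative_subset:
  assumes "continuous_map X Y f" "f \<in> topspace X \<rightarrow> T" "S \<subseteq> topspace X"
  shows "hom_induced p X S Y T f x = \<one>\<^bsub>relative_homology_group p Y T\<^esub>"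
proof -
  have f: "continuous_map X (subtopology Y T) f"
    using assms by (auto simp: continuous_map_in_subtopology)
  have "trivial_group (relative_homology_group p (subtopology Y T) T)"
    using trivial_relative_homology_group_topspace[of p "subtopology Y T"]
      relative_homology_group_restrict[of p "subtopology Y T" T]
    by (simp add: topspace_subtopology Int_commute Int_left_commute)
  then have 1: "hom_induced p X S (subtopology Y T) T f x = \<one>\<^bsub>relative_homology_group p (subtopology Y T) T\<^esub>"
    using hom_induced_carrier[of p X S "subtopology Y T" T f x] by (simp add: trivial_group_def)
  have "hom_induced p X S Y T (id \<circ> f) x
      = hom_induced p (subtopology Y T) T Y T id (hom_induced p X S (subtopology Y T) T f x)"
    using assms f
    by (intro hom_induced_compose'[symmetric]) (auto intro: continuous_map_from_subtopology)
  then show ?thesis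
    unfolding 1 using hom_one[OF hom_induced_hom, of p "subtopology Y T" T Y T id] by simp
qed

context finite_cw_complex
begin

lemma collapse_charmap_self:
  assumes "\<tau> \<in> cells K" "y \<in> closed_disc (cdim K \<tau>)"
  shows "collapse K \<tau> (charmap K \<tau> y) = pinch (cdim K \<tau>) y"
proof (cases "y \<in> open_disc (cdim K \<tau>)")
  case True
  then show ?thesis
    using charmap_open_disc[OF assms(1)] inv_into_f_f[OF charmap_inj[OF assms(1)] True]
    by (auto simp: collapse_def)
next
  case False
  then have y: "y \<in> disc_boundary (cdim K \<tau>)" using assms(2) closed_disc_eq by blast
  then have "charmap K \<tau> y \<notin> \<tau>"
    using charmap_boundary_skel[OF assms(1)] cell_Int_skel[OF assms(1)] by blast
  then show ?thesis using y by (simp add: collapse_def pinch_boundary)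
qed

lemma collapse_skel:
  assumes "\<tau> \<in> cells K" "x \<in> skel (cdim K \<tau>)" shows "collapse K \<tau> x = pinch_base"
  using cell_Int_skel[OF assms(1), of "cdim K \<tau>"] assms(2) by (auto simp: collapse_def)

lemma collapse_charmap_other:
  assumes "\<sigma> \<in> cells K" "\<tau> \<in> cells K" "cdim K \<sigma> = cdim K \<tau>" "\<sigma> \<noteq> \<tau>" "y \<in> closed_disc (cdim K \<sigma>)"
  shows "collapse K \<tau> (charmap K \<sigma> y) = pinch_base"
proof (cases "y \<in> open_disc (cdim K \<sigma>)")
  case True
  then have "charmap K \<sigma> y \<in> \<sigma>" using charmap_open_disc[OF assms(1)] by blast
  then have "charmap K \<sigma> y \<notin> \<tau>" using cells_disjointD[OF assms(1,2)] assms(4) by blast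
  then show ?thesis by (simp add: collapse_def)
next
  case False
  then have "y \<in> disc_boundary (cdim K \<sigma>)" using assms(5) closed_disc_eq by blast
  then have "charmap K \<sigma> y \<in> skel (cdim K \<tau>)"
    using charmap_boundary_skel[OF assms(1)] assms(3) by auto
  then show ?thesis by (rule collapse_skel[OF assms(2)])
qed

lemma continuous_map_collapse:
  assumes \<tau>: "\<tau> \<in> cells K" and n: "cdim K \<tau> = n"
  shows "continuous_map (subspace (skel (Suc n))) (nsphere n) (collapse K \<tau>)"
proof (rule continuous_map_closed_cover)
  let ?T = "{\<sigma> \<in> cells K. cdim K \<sigma> = n} - {\<tau>}"
  let ?A = "skel n \<union> \<Union>?T"
  have top: "topspace (subspace (skel (Suc n))) = skel (Suc n)"
    using skel_subset_space by (simp add: topspace_subtopology inf.absorb2)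
  have A: "?A \<subseteq> skel (Suc n)" by (auto simp: skel_Suc)
  have "closedin (cw_space K) ?A"
    by (rule closedin_skel_Union) auto
  then show "closedin (subspace (skel (Suc n))) ?A"
    using A by (intro closedin_subset_topspace) auto
  have base: "collapse K \<tau> x = pinch_base" if "x \<in> ?A" for x
  proof -
    have "x \<notin> \<tau>" using that cells_disjointD[OF \<tau>] cell_Int_skel[OF \<tau>] n by blast
    then show ?thesis by (simp add: collapse_def)
  qed
  have "continuous_map (subtopology (subspace (skel (Suc n))) ?A) (nsphere n) (\<lambda>x. pinch_base)"
    using pinch_base_in_nsphere by simp
  then show "continuous_map (subtopology (subspace (skel (Suc n))) ?A) (nsphere n) (collapse K \<tau>)"
    by (rule continuous_map_eq) (use base in auto)
  have "skel n \<subseteq> skel (Suc n)" by (simp add: skel_mono)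
  then have \<Phi>: "continuous_map (disc n) (subspace (skel (Suc n))) (charmap K \<tau>)"
    using charmap_continuous_into[OF \<tau>, of "skel (Suc n)"] cell_subset_skel[OF \<tau>, of "Suc n"] n by simp
  then show "closed_map (disc n) (subspace (skel (Suc n))) (charmap K \<tau>)"
    using T1_Spaces.continuous_imp_closed_map compact_space_disc Hausdorff_space_subtopology[OF hausdorff] by blast
  show "continuous_map (disc n) (nsphere n) (collapse K \<tau> \<circ> charmap K \<tau>)"
    by (rule continuous_map_eq[OF continuous_map_pinch])
       (use collapse_charmap_self[OF \<tau>] n topspace_disc[of n] in auto)
  have "\<tau> \<subseteq> charmap K \<tau> ` closed_disc n"
    using charmap_open_disc[OF \<tau>] open_disc_subset n by blast
  moreover have "skel (Suc n) = ?A \<union> \<tau>" using \<tau> n by (auto simp: skel_Suc)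
  moreover have "charmap K \<tau> ` closed_disc n \<subseteq> skel (Suc n)"
    using continuous_map_image_subset_topspace[OF \<Phi>] unfolding topspace_disc top .
  moreover have "S = A \<union> C" if "T \<subseteq> C" "S = A \<union> T" "C \<subseteq> S" for S A T C :: "'a set"
    using that by blast
  ultimately show "topspace (subspace (skel (Suc n))) = ?A \<union> charmap K \<tau> ` topspace (disc n)"
    unfolding top topspace_disc by metis
qed

lemma continuous_map_attaching:
  assumes "\<sigma> \<in> cells K" "cdim K \<sigma> = Suc n"
  shows "continuous_map (nsphere n) (subspace (skel (Suc n))) (charmap K \<sigma>)"
proof -
  have "continuous_map (nsphere n) (cw_space K) (charmap K \<sigma>)"
    unfolding subtopology_disc_boundary[symmetric]
    using charmap_continuous[OF assms(1)] unfolding assms(2) by (rule continuous_map_from_subtopology)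
  moreover have "charmap K \<sigma> \<in> topspace (nsphere n) \<rightarrow> skel (Suc n)"
    using charmap_boundary_skel[OF assms(1)] unfolding topspace_nsphere assms(2) by blast
  ultimately show ?thesis by (rule continuous_map_into_subtopology)
qed

theorem incidence_degree_sum:
  assumes \<sigma>: "\<sigma> \<in> cells K" "cdim K \<sigma> = Suc (Suc m)" and \<rho>: "\<rho> \<in> cells K" "cdim K \<rho> = m"
  shows "(\<Sum>\<tau> | \<tau> \<in> cells K \<and> cdim K \<tau> = Suc m.
      Brouwer_degree2 (Suc m) (collapse K \<tau> \<circ> charmap K \<sigma>)
      * Brouwer_degree2 m (collapse K \<rho> \<circ> charmap K \<tau>)) = 0"
proof -
  let ?n = "Suc m"
  define p where "p = int ?n"
  let ?D = "disc ?n" and ?S = "disc_boundary ?n" and ?Sn = "nsphere ?n" and ?Sm = "nsphere m"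
  let ?E = "subspace (skel (Suc ?n))" and ?B = "skel ?n"
  let ?C = "{\<tau> \<in> cells K. cdim K \<tau> = ?n}"
  let ?b = "pinch_base"
  let ?Rn = "reduced_homology_group p ?Sn" and ?Rm = "reduced_homology_group (int m) ?Sm"
  let ?Q = "relative_homology_group p ?Sn {?b}" and ?G = "relative_homology_group p ?E ?B"
  let ?H = "relative_homology_group p ?D ?S"
  let ?J = "hom_induced p ?Sn {} ?Sn {?b} id"
  let ?col = "\<lambda>\<tau>. hom_induced p ?E ?B ?Sn {?b} (collapse K \<tau>)"
  let ?\<Phi> = "\<lambda>\<tau>. hom_induced p ?D ?S ?E ?B (charmap K \<tau>)"
  let ?bdE = "hom_boundary p ?E ?B" and ?bdD = "hom_boundary p ?D ?S"
  let ?r = "hom_induced (int m) (subspace ?B) {} ?Sm {} (collapse K \<rho>)"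
  have pm: "p - 1 = int m" by (simp add: p_def)
  have EB: "subtopology ?E ?B = subspace ?B"
    using skel_mono[of ?n "Suc ?n"] by (simp add: subtopology_subtopology inf.absorb2)
  have DS: "subtopology ?D ?S = ?Sm" by (rule subtopology_disc_boundary)
  obtain s where s: "s \<in> carrier ?Rn"
    "\<And>x. x \<in> carrier ?Rn \<Longrightarrow> \<exists>k::int. x = s [^]\<^bsub>?Rn\<^esub> k"
    "\<And>i j::int. s [^]\<^bsub>?Rn\<^esub> i = s [^]\<^bsub>?Rn\<^esub> j \<Longrightarrow> i = j"
    unfolding p_def using nsphere_reduced_generator[of ?n] by blast
  obtain s' where s': "s' \<in> carrier ?Rm"
    "\<And>x. x \<in> carrier ?Rm \<Longrightarrow> \<exists>k::int. x = s' [^]\<^bsub>?Rm\<^esub> k"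
    "\<And>i j::int. s' [^]\<^bsub>?Rm\<^esub> i = s' [^]\<^bsub>?Rm\<^esub> j \<Longrightarrow> i = j"
    using nsphere_reduced_generator[of m] by blast
  have "topspace ?Sn \<inter> {?b} \<noteq> {}" using pinch_base_in_nsphere[of ?n] by simp
  then have Jiso: "?J \<in> iso ?Rn ?Q"
    using pinch_base_in_nsphere[of ?n]
    by (intro iso_reduced_homology_by_contractible contractible_space_subtopology_singleton) auto
  have "topspace ?D \<inter> ?S \<noteq> {}"
    using disc_boundary_nonempty[of m] disc_boundary_subset[of ?n] topspace_disc[of ?n] by blast
  then have bdiso: "?bdD \<in> iso ?H ?Rm"
    using iso_relative_homology_of_contractible[OF contractible_space_disc[of ?n], of ?S p]
    unfolding DS pm by blast
  interpret Rn: group ?Rn by simp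
  interpret Rm: group ?Rm by simp
  interpret Q: group ?Q by simp
  interpret H: group ?H by simp
  interpret J: group_hom ?Rn ?Q ?J
    using Jiso by unfold_locales (simp add: iso_def)
  interpret bdD: group_hom ?H ?Rm ?bdD
    using bdiso by unfold_locales (simp add: iso_def)
  define sh where "sh \<equiv> ?J s"
  have sh: "sh \<in> carrier ?Q" using s(1) by (simp add: sh_def)
  have J_pow: "?J (s [^]\<^bsub>?Rn\<^esub> k) = sh [^]\<^bsub>?Q\<^esub> k" for k :: int
    using s(1) by (simp add: sh_def J.hom_int_pow)
  have sh_inj: "i = j" if "sh [^]\<^bsub>?Q\<^esub> i = sh [^]\<^bsub>?Q\<^esub> j" for i j :: int
  proof -
    have "?J (s [^]\<^bsub>?Rn\<^esub> i) = ?J (s [^]\<^bsub>?Rn\<^esub> j)" using that by (simp only: J_pow)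
    then have "s [^]\<^bsub>?Rn\<^esub> i = s [^]\<^bsub>?Rn\<^esub> j"
      using Jiso s(1) inj_onD[of ?J "carrier ?Rn"] unfolding iso_iff by blast
    then show ?thesis by (rule s(3))
  qed
  obtain \<epsilon> where \<epsilon>: "\<epsilon> \<in> carrier ?H" "?bdD \<epsilon> = s'"
  proof -
    have "?bdD ` carrier ?H = carrier ?Rm" using bdiso by (simp add: iso_iff)
    then have "s' \<in> ?bdD ` carrier ?H" using s'(1) by simp
    then show thesis using that by (elim imageE) simp
  qed
  have pinch_hom: "hom_induced p ?D ?S ?Sn {?b} (pinch ?n) \<in> hom ?H ?Q" by (rule hom_induced_hom)
  interpret pinch: group_hom ?H ?Q "hom_induced p ?D ?S ?Sn {?b} (pinch ?n)"
    using pinch_hom by unfold_locales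
  have "hom_induced p ?D ?S ?Sn {?b} (pinch ?n) \<epsilon> \<in> ?J ` carrier ?Rn"
    using Jiso \<epsilon>(1) by (simp add: iso_iff)
  then obtain z where "z \<in> carrier ?Rn" "hom_induced p ?D ?S ?Sn {?b} (pinch ?n) \<epsilon> = ?J z"
    by (elim imageE)
  then obtain \<eta> :: int where \<eta>: "hom_induced p ?D ?S ?Sn {?b} (pinch ?n) \<epsilon> = sh [^]\<^bsub>?Q\<^esub> \<eta>"
    using s(2)[of z] J_pow by metis
  define deg where "deg \<equiv> \<lambda>\<tau>. Brouwer_degree2 m (collapse K \<rho> \<circ> charmap K \<tau>)"
  have r_hom: "?r \<circ> ?bdE \<in> hom ?G ?Rm"
    using hom_compose[OF hom_boundary_reduced_hom[of p ?E ?B] hom_induced_reduced_hom[of "p - 1" "subtopology ?E ?B" ?Sm "collapse K \<rho>"]]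
    unfolding EB pm .
  \<comment> \<open>The degree \<open>\<eta>\<close> of the pinch map need not be determined: it multiplies an integer \<open>d\<close> that vanishes
    for the class of the attaching map of \<open>\<sigma>\<close>.\<close>
  define P where "P \<equiv> \<lambda>y. \<exists>c d. (\<forall>\<tau>\<in>?C. ?col \<tau> y = sh [^]\<^bsub>?Q\<^esub> (c \<tau> :: int))
      \<and> ?r (?bdE y) = s' [^]\<^bsub>?Rm\<^esub> (d :: int) \<and> \<eta> * d = (\<Sum>\<tau>\<in>?C. c \<tau> * deg \<tau>)"
  have P: "P y" if "y \<in> carrier ?G" for y
    using that
  proof (induction rule: skel_homology_induct)
    case one
    have "?r (?bdE \<one>\<^bsub>?G\<^esub>) = \<one>\<^bsub>?Rm\<^esub>"
      using hom_one[OF r_hom] by simp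
    moreover have "?col \<tau> \<one>\<^bsub>?G\<^esub> = \<one>\<^bsub>?Q\<^esub>" for \<tau>
      by (rule hom_one[OF hom_induced_hom]) auto
    ultimately show ?case
      unfolding P_def by (intro exI[of _ "\<lambda>_. 0"] exI[of _ 0]) (simp del: one_relative_homology_group)
  next
    case (mult x y)
    from mult(3) obtain c d where x: "\<And>\<tau>. \<tau> \<in> ?C \<Longrightarrow> ?col \<tau> x = sh [^]\<^bsub>?Q\<^esub> (c \<tau> :: int)"
      "?r (?bdE x) = s' [^]\<^bsub>?Rm\<^esub> (d :: int)" "\<eta> * d = (\<Sum>\<tau>\<in>?C. c \<tau> * deg \<tau>)"
      unfolding P_def by blast
    from mult(4) obtain c' d' where y: "\<And>\<tau>. \<tau> \<in> ?C \<Longrightarrow> ?col \<tau> y = sh [^]\<^bsub>?Q\<^esub> (c' \<tau> :: int)"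
      "?r (?bdE y) = s' [^]\<^bsub>?Rm\<^esub> (d' :: int)" "\<eta> * d' = (\<Sum>\<tau>\<in>?C. c' \<tau> * deg \<tau>)"
      unfolding P_def by blast
    have "?col \<tau> (x \<otimes>\<^bsub>?G\<^esub> y) = sh [^]\<^bsub>?Q\<^esub> (c \<tau> + c' \<tau>)" if "\<tau> \<in> ?C" for \<tau>
      using hom_mult[OF hom_induced_hom mult(1,2), of ?Sn "{?b}" "collapse K \<tau>"] x(1)[OF that] y(1)[OF that] sh
      by (simp add: Q.int_pow_mult)
    moreover have "?r (?bdE (x \<otimes>\<^bsub>?G\<^esub> y)) = s' [^]\<^bsub>?Rm\<^esub> (d + d')"
      using hom_mult[OF r_hom mult(1,2)] x(2) y(2) s'(1) by (simp add: Rm.int_pow_mult)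
    moreover have "\<eta> * (d + d') = (\<Sum>\<tau>\<in>?C. (c \<tau> + c' \<tau>) * deg \<tau>)"
      using x(3) y(3) by (simp add: algebra_simps sum.distrib)
    ultimately show ?case
      unfolding P_def by (intro exI[of _ "\<lambda>\<tau>. c \<tau> + c' \<tau>"] exI[of _ "d + d'"]) simp
  next
    case (cell \<tau> a)
    have \<tau>: "\<tau> \<in> ?C" "\<tau> \<in> cells K" "cdim K \<tau> = ?n" using cell by auto
    obtain k :: int where k: "?bdD a = s' [^]\<^bsub>?Rm\<^esub> k"
      using s'(2)[OF bdD.hom_closed[OF cell(3)]] ..
    then have "?bdD a = ?bdD (\<epsilon> [^]\<^bsub>?H\<^esub> k)" using \<epsilon> by (simp add: bdD.hom_int_pow)
    then have a: "a = \<epsilon> [^]\<^bsub>?H\<^esub> k"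
      using bdiso cell(3) \<epsilon>(1) inj_onD[of ?bdD "carrier ?H"]
      by (simp only: iso_iff) (metis H.int_pow_closed)
    have \<Phi>: "continuous_map ?D ?E (charmap K \<tau>)"
      using charmap_continuous_into[OF \<tau>(2), of "skel (Suc ?n)"] cell_subset_skel[OF \<tau>(2), of "Suc ?n"]
        skel_mono[of ?n "Suc ?n"] \<tau>(3) by simp
    have \<Phi>bd: "charmap K \<tau> \<in> ?S \<rightarrow> ?B"
      using charmap_boundary_skel[OF \<tau>(2)] \<tau>(3) by auto
    have col: "?col \<upsilon> (?\<Phi> \<tau> a) = sh [^]\<^bsub>?Q\<^esub> (if \<upsilon> = \<tau> then \<eta> * k else 0)" if \<upsilon>: "\<upsilon> \<in> ?C" for \<upsilon>
    proof -
      have c: "continuous_map ?E ?Sn (collapse K \<upsilon>)" using \<upsilon> by (intro continuous_map_collapse) auto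
      have "?col \<upsilon> (?\<Phi> \<tau> a) = hom_induced p ?D ?S ?Sn {?b} (collapse K \<upsilon> \<circ> charmap K \<tau>) a"
        using \<upsilon> collapse_skel[of \<upsilon>] by (intro hom_induced_compose' \<Phi> \<Phi>bd c) auto
      also have "\<dots> = sh [^]\<^bsub>?Q\<^esub> (if \<upsilon> = \<tau> then \<eta> * k else 0)"
      proof (cases "\<upsilon> = \<tau>")
        case True
        have "hom_induced p ?D ?S ?Sn {?b} (collapse K \<upsilon> \<circ> charmap K \<tau>) a
            = hom_induced p ?D ?S ?Sn {?b} (pinch ?n) a"
          using collapse_charmap_self[OF \<tau>(2)] \<tau>(3) topspace_disc[of ?n] True
          by (subst hom_induced_eq[where f = "collapse K \<upsilon> \<circ> charmap K \<tau>" and g = "pinch ?n"]) (auto simp del: topspace_subtopology)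
        also have "\<dots> = sh [^]\<^bsub>?Q\<^esub> (\<eta> * k)"
          using \<epsilon>(1) sh by (simp add: a pinch.hom_int_pow \<eta> Q.int_pow_pow)
        finally show ?thesis using True by simp
      next
        case False
        then have "(collapse K \<upsilon> \<circ> charmap K \<tau>) \<in> topspace ?D \<rightarrow> {?b}"
          using collapse_charmap_other[of \<tau> \<upsilon>] \<tau> \<upsilon> topspace_disc[of ?n] by (auto simp del: topspace_subtopology)
        then have "hom_induced p ?D ?S ?Sn {?b} (collapse K \<upsilon> \<circ> charmap K \<tau>) a = \<one>\<^bsub>?Q\<^esub>"
          using disc_boundary_subset[of ?n] topspace_disc[of ?n]
          by (intro hom_induced_into_relative_subset continuous_map_compose[OF \<Phi> c]) auto
        then show ?thesis using False by simp
      qed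
      finally show ?thesis .
    qed
    have "?bdE (?\<Phi> \<tau> a) = hom_induced (int m) ?Sm {} (subspace ?B) {} (charmap K \<tau>) (?bdD a)"
      using fun_cong[OF naturality_hom_induced[OF \<Phi> \<Phi>bd, of p], of a] unfolding EB DS pm by simp
    moreover have c\<rho>: "continuous_map (subspace ?B) ?Sm (collapse K \<rho>)"
      by (rule continuous_map_collapse[OF \<rho>])
    moreover have "continuous_map ?Sm (subspace ?B) (charmap K \<tau>)"
      using continuous_map_attaching[OF \<tau>(2,3)] .
    ultimately have "?r (?bdE (?\<Phi> \<tau> a))
        = hom_induced (int m) ?Sm {} ?Sm {} (collapse K \<rho> \<circ> charmap K \<tau>) (s' [^]\<^bsub>?Rm\<^esub> k)"
      using k by (simp add: hom_induced_compose')
    also have "\<dots> = s' [^]\<^bsub>?Rm\<^esub> (k * deg \<tau>)"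
      using s'(1) by (simp add: Brouwer_degree2 deg_def Rm.int_pow_pow)
    finally have r: "?r (?bdE (?\<Phi> \<tau> a)) = s' [^]\<^bsub>?Rm\<^esub> (k * deg \<tau>)" .
    have "(\<Sum>\<upsilon>\<in>?C. (if \<upsilon> = \<tau> then \<eta> * k else 0) * deg \<upsilon>) = (\<Sum>\<upsilon>\<in>?C. if \<upsilon> = \<tau> then \<eta> * k * deg \<upsilon> else 0)"
      by (rule sum.cong) auto
    also have "\<dots> = \<eta> * (k * deg \<tau>)"
      using \<tau>(1) finite_cells by simp
    finally have "\<eta> * (k * deg \<tau>) = (\<Sum>\<upsilon>\<in>?C. (if \<upsilon> = \<tau> then \<eta> * k else 0) * deg \<upsilon>)" by simp
    then show ?case
      unfolding P_def using col r
      by (intro exI[of _ "\<lambda>\<upsilon>. if \<upsilon> = \<tau> then \<eta> * k else 0"] exI[of _ "k * deg \<tau>"]) blast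
  qed
  define x where "x \<equiv> hom_induced p ?Sn {} ?E {} (charmap K \<sigma>) s"
  define y where "y \<equiv> hom_induced p ?E {} ?E ?B id x"
  have \<phi>: "continuous_map ?Sn ?E (charmap K \<sigma>)"
    by (rule continuous_map_attaching[OF \<sigma>])
  have "x \<in> carrier (homology_group p ?E)" by (simp add: x_def hom_induced_carrier)
  then have "y \<in> kernel ?G (homology_group (p - 1) (subtopology ?E ?B)) ?bdE"
    using homology_exactness_axiom_1[of p ?E ?B] unfolding y_def by (simp)
  then have "?bdE y = \<one>\<^bsub>reduced_homology_group (int m) (subspace ?B)\<^esub>"
    unfolding EB pm one_reduced_homology_group by (simp add: kernel_def del: one_relative_homology_group)
  then have ry: "?r (?bdE y) = \<one>\<^bsub>?Rm\<^esub>"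
    using hom_one[OF hom_induced_reduced_hom] by simp
  have coly: "?col \<tau> y = sh [^]\<^bsub>?Q\<^esub> Brouwer_degree2 ?n (collapse K \<tau> \<circ> charmap K \<sigma>)" if \<tau>: "\<tau> \<in> ?C" for \<tau>
  proof -
    have c: "continuous_map ?E ?Sn (collapse K \<tau>)" using \<tau> by (intro continuous_map_collapse) auto
    have "?col \<tau> y = hom_induced p ?E {} ?Sn {?b} (collapse K \<tau> \<circ> id) x"
      unfolding y_def using \<tau> collapse_skel[of \<tau>] by (intro hom_induced_compose' c) auto
    also have "\<dots> = hom_induced p ?Sn {} ?Sn {?b} (collapse K \<tau> \<circ> id \<circ> charmap K \<sigma>) s"
      unfolding x_def using c by (intro hom_induced_compose' \<phi>) auto
    also have "\<dots> = ?J (hom_induced p ?Sn {} ?Sn {} (collapse K \<tau> \<circ> charmap K \<sigma>) s)"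
      using hom_induced_compose'[OF continuous_map_compose[OF \<phi> c], of "{}" "{}" ?Sn id "{?b}" p s] by simp
    also have "\<dots> = sh [^]\<^bsub>?Q\<^esub> Brouwer_degree2 ?n (collapse K \<tau> \<circ> charmap K \<sigma>)"
      using Brouwer_degree2[of s ?n] s(1) J_pow unfolding p_def by simp
    finally show ?thesis .
  qed
  have "P y" by (rule P) (simp add: y_def hom_induced_carrier)
  then obtain c d where c: "\<And>\<tau>. \<tau> \<in> ?C \<Longrightarrow> ?col \<tau> y = sh [^]\<^bsub>?Q\<^esub> (c \<tau> :: int)"
    and d: "?r (?bdE y) = s' [^]\<^bsub>?Rm\<^esub> (d :: int)" and sum: "\<eta> * d = (\<Sum>\<tau>\<in>?C. c \<tau> * deg \<tau>)"
    unfolding P_def by blast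
  have "d = 0" using s'(3)[of d 0] d ry by simp
  moreover have "c \<tau> = Brouwer_degree2 ?n (collapse K \<tau> \<circ> charmap K \<sigma>)" if "\<tau> \<in> ?C" for \<tau>
    using sh_inj c[OF that] coly[OF that] by simp
  ultimately show ?thesis using sum by (simp add: deg_def)
qed

theorem incidence_incidence:
  assumes "\<sigma> \<in> cells K" "\<rho> \<in> cells K"
  shows "(\<Sum>\<tau>\<in>cells K. incidence K \<sigma> \<tau> * incidence K \<tau> \<rho>) = 0"
proof (cases "cdim K \<sigma> = Suc (Suc (cdim K \<rho>))")
  case True
  let ?m = "cdim K \<rho>"
  let ?C = "{\<tau> \<in> cells K. cdim K \<tau> = Suc ?m}"
  have "(\<Sum>\<tau>\<in>cells K. incidence K \<sigma> \<tau> * incidence K \<tau> \<rho>) = (\<Sum>\<tau>\<in>?C. incidence K \<sigma> \<tau> * incidence K \<tau> \<rho>)"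
    using finite_cells by (intro sum.mono_neutral_right) (auto simp: incidence_def)
  also have "\<dots> = (\<Sum>\<tau>\<in>?C. cw_sign K \<sigma> * cw_sign K \<rho> * (Brouwer_degree2 (Suc ?m) (collapse K \<tau> \<circ> charmap K \<sigma>)
      * Brouwer_degree2 ?m (collapse K \<rho> \<circ> charmap K \<tau>)))"
  proof (rule sum.cong)
    fix \<tau> assume \<tau>: "\<tau> \<in> ?C"
    then have "cw_sign K \<tau> * cw_sign K \<tau> = 1" using cw_sign[of \<tau>] by auto
    then show "incidence K \<sigma> \<tau> * incidence K \<tau> \<rho> = cw_sign K \<sigma> * cw_sign K \<rho> *
        (Brouwer_degree2 (Suc ?m) (collapse K \<tau> \<circ> charmap K \<sigma>) * Brouwer_degree2 ?m (collapse K \<rho> \<circ> charmap K \<tau>))"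
      using \<tau> True by (simp add: incidence_def) 
  qed simp
  also have "\<dots> = 0"
    using incidence_degree_sum[OF assms(1) True assms(2) refl] by (simp flip: sum_distrib_left)
  finally show ?thesis .
next
  case False
  then show ?thesis by (intro sum.neutral) (auto simp: incidence_def)
qed

end

section \<open>Quotients of function spaces\<close>

definition function_subspace :: "('i \<Rightarrow> 'k::field) set \<Rightarrow> bool" where
  "function_subspace Z \<longleftrightarrow> (\<lambda>_. 0) \<in> Z \<and> (\<forall>x\<in>Z. \<forall>y\<in>Z. (\<lambda>i. x i + y i) \<in> Z) \<and>
     (\<forall>a. \<forall>x\<in>Z. (\<lambda>i. a * x i) \<in> Z)"

lemma function_subspaceD:
  assumes "function_subspace Z"
  shows "(\<lambda>_. 0) \<in> Z" "\<lbrakk>x \<in> Z; y \<in> Z\<rbrakk> \<Longrightarrow> (\<lambda>i. x i + y i) \<in> Z" "x \<in> Z \<Longrightarrow> (\<lambda>i. a * x i) \<in> Z"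
  using assms by (auto simp: function_subspace_def)

lemma function_subspace_diff:
  assumes "function_subspace Z" "x \<in> Z" "y \<in> Z" shows "(\<lambda>i. x i - y i) \<in> Z"
  using function_subspaceD(2)[OF assms(1,2) function_subspaceD(3)[OF assms(1,3), of "-1"]] by simp

lemma function_subspace_sum:
  assumes "function_subspace Z" "\<And>v. v \<in> S \<Longrightarrow> g v \<in> Z" shows "(\<lambda>i. \<Sum>v\<in>S. g v i) \<in> Z"
  using assms(2)
proof (induction S rule: infinite_finite_induct)
  case (insert v S)
  then show ?case using function_subspaceD(2)[OF assms(1), of "g v" "\<lambda>i. \<Sum>v\<in>S. g v i"] by simp
qed (use function_subspaceD(1)[OF assms(1)] in auto)

definition coset :: "('i \<Rightarrow> 'k::field) set \<Rightarrow> ('i \<Rightarrow> 'k) \<Rightarrow> ('i \<Rightarrow> 'k) set" where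
  "coset B c = {x. (\<lambda>i. x i - c i) \<in> B}"

lemma r_coset_fun_module: "B +>\<^bsub>fun_module Z\<^esub> c = coset B c"
proof -
  have "x \<in> (\<Union>h\<in>B. {\<lambda>i. h i + c i}) \<longleftrightarrow> (\<lambda>i. x i - c i) \<in> B" for x
  proof
    assume "(\<lambda>i. x i - c i) \<in> B"
    then show "x \<in> (\<Union>h\<in>B. {\<lambda>i. h i + c i})" by (intro UN_I[of "\<lambda>i. x i - c i"]) auto
  qed auto
  then show ?thesis by (auto simp: a_r_coset_def' coset_def fun_module_def)
qed

lemma coset_self: "function_subspace B \<Longrightarrow> c \<in> coset B c"
  by (simp add: coset_def function_subspaceD)

lemma coset_eq_iff:
  assumes B: "function_subspace B"
  shows "coset B c = coset B d \<longleftrightarrow> (\<lambda>i. c i - d i) \<in> B"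
proof
  assume "coset B c = coset B d"
  then have "c \<in> coset B d" using coset_self[OF B] by blast
  then show "(\<lambda>i. c i - d i) \<in> B" by (simp add: coset_def)
next
  assume cd: "(\<lambda>i. c i - d i) \<in> B"
  show "coset B c = coset B d"
    using function_subspace_diff[OF B _ cd] function_subspaceD(2)[OF B _ cd]
    by (fastforce simp: coset_def)
qed

lemma coset_zero: "coset B (\<lambda>_. 0) = B"
  by (simp add: coset_def)

locale quotient_function_space =
  fixes Z B :: "('i \<Rightarrow> 'k::field) set"
  assumes Z: "function_subspace Z" and B: "function_subspace B" and BZ: "B \<subseteq> Z"
begin

abbreviation Q :: "('k, ('i \<Rightarrow> 'k) set) module" where
  "Q \<equiv> quotient_module (fun_module Z) B"

lemma carrier_Q: "carrier Q = coset B ` Z"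
  by (auto simp: quotient_module_def A_RCOSETS_def' r_coset_fun_module) (auto simp: fun_module_def)

lemma zero_Q: "\<zero>\<^bsub>Q\<^esub> = coset B (\<lambda>_. 0)"
  by (simp add: quotient_module_def coset_zero)

lemma add_Q: "coset B c \<oplus>\<^bsub>Q\<^esub> coset B d = coset B (\<lambda>i. c i + d i)"
proof -
  have "coset B c \<oplus>\<^bsub>Q\<^esub> coset B d = (\<Union>h\<in>coset B c. \<Union>k\<in>coset B d. {\<lambda>i. h i + k i})"
    by (simp add: quotient_module_def set_add_def' fun_module_def)
  also have "\<dots> = coset B (\<lambda>i. c i + d i)"
  proof (intro equalityI subsetI)
    fix x assume "x \<in> (\<Union>h\<in>coset B c. \<Union>k\<in>coset B d. {\<lambda>i. h i + k i})"
    then obtain h k where "(\<lambda>i. h i - c i) \<in> B" "(\<lambda>i. k i - d i) \<in> B" "x = (\<lambda>i. h i + k i)"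
      by (auto simp: coset_def)
    then show "x \<in> coset B (\<lambda>i. c i + d i)"
      using function_subspaceD(2)[OF B, of "\<lambda>i. h i - c i" "\<lambda>i. k i - d i"]
      by (simp add: coset_def algebra_simps)
  next
    fix x assume "x \<in> coset B (\<lambda>i. c i + d i)"
    then have "(\<lambda>i. x i - d i) \<in> coset B c" by (simp add: coset_def algebra_simps)
    then show "x \<in> (\<Union>h\<in>coset B c. \<Union>k\<in>coset B d. {\<lambda>i. h i + k i})"
      using coset_self[OF B, of d] by (intro UN_I[of "\<lambda>i. x i - d i"] UN_I[of d]) auto
  qed
  finally show ?thesis .
qed

lemma smult_Q: "a \<odot>\<^bsub>Q\<^esub> coset B c = coset B (\<lambda>i. a * c i)"
proof -
  have "coset B (\<lambda>i. a * x i) = coset B (\<lambda>i. a * c i)" if "x \<in> coset B c" for x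
    using function_subspaceD(3)[OF B, of "\<lambda>i. x i - c i" a] that
    by (subst coset_eq_iff[OF B]) (simp add: coset_def algebra_simps)
  then have "(\<Union>x\<in>coset B c. coset B (\<lambda>i. a * x i)) = coset B (\<lambda>i. a * c i)"
    using coset_self[OF B, of c] by blast
  then show ?thesis
    by (simp add: quotient_module_def r_coset_fun_module) (simp add: fun_module_def)
qed

lemma abelian_group_Q: "abelian_group Q"
proof (rule abelian_groupI)
  fix x assume "x \<in> carrier Q"
  then obtain c where c: "c \<in> Z" "x = coset B c" by (auto simp: carrier_Q)
  show "\<exists>y\<in>carrier Q. y \<oplus>\<^bsub>Q\<^esub> x = \<zero>\<^bsub>Q\<^esub>"
    using function_subspaceD(3)[OF Z c(1), of "-1"] c(2)
    by (intro bexI[of _ "coset B (\<lambda>i. - 1 * c i)"]) (auto simp: carrier_Q add_Q zero_Q)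
qed (auto simp: carrier_Q add_Q zero_Q function_subspaceD[OF Z] algebra_simps)

lemma vectorspace_Q: "vectorspace class_ring Q"
proof -
  have "module (class_ring :: 'k ring) Q"
  proof (rule Module.moduleI)
    show "cring (class_ring :: 'k ring)" by unfold_locales
    show "abelian_group Q" by (rule abelian_group_Q)
  qed (auto simp: carrier_Q smult_Q add_Q function_subspaceD[OF Z] algebra_simps)
  moreover have "field (class_ring :: 'k ring)" by unfold_locales
  ultimately show ?thesis by (simp add: vectorspace_def)
qed

lemma finsum_Q:
  assumes "\<And>v. v \<in> S \<Longrightarrow> g v \<in> Z"
  shows "finsum Q (\<lambda>v. coset B (g v)) S = coset B (\<lambda>i. \<Sum>v\<in>S. g v i)"
  using assms
proof (induction S rule: infinite_finite_induct)
  interpret Q: abelian_group Q by (rule abelian_group_Q)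
  {
    case (infinite S)
    then show ?case by (simp add: finsum_def finprod_def zero_Q)
  next
    case empty
    then show ?case by (simp add: zero_Q)
  next
    case (insert v S)
    then show ?case by (simp add: Q.finsum_insert carrier_Q Pi_iff add_Q)
  }
qed

end

section \<open>Cellular chains and cochains\<close>

definition restrict_cochain :: "'a cw_complex \<Rightarrow> 'a set \<Rightarrow> nat \<Rightarrow> ('a, 'k::field) chain \<Rightarrow> ('a, 'k) chain" where
  "restrict_cochain K A q \<phi> = (\<lambda>\<sigma>. if \<sigma> \<in> cells_in K A q then \<phi> \<sigma> else 0)"

context finite_cw_complex
begin

lemma cell_nonempty: "\<sigma> \<in> cells K \<Longrightarrow> \<sigma> \<noteq> {}"
proof -
  assume "\<sigma> \<in> cells K"
  moreover have "(\<lambda>_. 0) \<in> open_disc (cdim K \<sigma>)"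
    by (simp add: open_disc_def sqnorm_def topspace_Euclidean_space)
  ultimately show ?thesis using charmap_open_disc by blast
qed

lemma charmap_closed_disc_subset:
  assumes \<sigma>: "\<sigma> \<in> cells K" and A: "closedin (cw_space K) A" "\<sigma> \<subseteq> A"
  shows "charmap K \<sigma> ` closed_disc (cdim K \<sigma>) \<subseteq> A"
proof (rule image_subsetI)
  fix y assume y: "y \<in> closed_disc (cdim K \<sigma>)"
  let ?\<gamma> = "\<lambda>r::real. \<lambda>i. r * y i"
  have \<gamma>: "continuous_map (top_of_set {0..1}) (disc (cdim K \<sigma>)) ?\<gamma>"
  proof (subst continuous_map_into_Euclidean_subspace[OF closed_disc_subset], intro conjI allI)
    show "continuous_map (top_of_set {0..1}) euclideanreal (\<lambda>r. r * y i)" for i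
      by (simp add: continuous_on_mult_right)
    show "?\<gamma> \<in> topspace (top_of_set {0..1}) \<rightarrow> closed_disc (cdim K \<sigma>)"
      using y by (auto intro!: scaled_in_closed_disc)
  qed
  have "continuous_map (top_of_set {0..1}) (cw_space K) (charmap K \<sigma> \<circ> ?\<gamma>)"
    by (rule continuous_map_compose[OF \<gamma> charmap_continuous[OF \<sigma>]])
  from closedin_continuous_map_preimage[OF this A(1)]
  have "closedin (top_of_set {0..1}) {r \<in> {0..1}. charmap K \<sigma> (?\<gamma> r) \<in> A}"
    by simp
  then have cl: "closed {r \<in> {0..1}. charmap K \<sigma> (?\<gamma> r) \<in> A}"
    by (rule closedin_closed_trans) simp
  have "?\<gamma> r \<in> open_disc (cdim K \<sigma>)" if "0 \<le> r" "r < 1" for r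
  proof -
    have "r\<^sup>2 * sqnorm (cdim K \<sigma>) y \<le> r\<^sup>2 * 1"
      using y by (intro mult_left_mono) (auto simp: closed_disc_def)
    also have "\<dots> < 1" using that by (simp add: power_less_one_iff abs_square_less_1)
    finally show ?thesis
      using y by (simp add: open_disc_def closed_disc_def sqnorm_scale topspace_Euclidean_space)
  qed
  then have "{0..<1} \<subseteq> {r \<in> {0..1}. charmap K \<sigma> (?\<gamma> r) \<in> A}"
    using charmap_open_disc[OF \<sigma>] A(2) by auto
  from closure_minimal[OF this cl]
  have "{0..1} \<subseteq> {r \<in> {0..1}. charmap K \<sigma> (?\<gamma> r) \<in> A}"
    by simp
  then have "1 \<in> {r \<in> {0..1::real}. charmap K \<sigma> (?\<gamma> r) \<in> A}"
    by (rule subsetD) simp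
  then show "charmap K \<sigma> y \<in> A" by simp
qed

lemma incidence_support:
  assumes A: "cw_subcomplex K A" and \<sigma>: "\<sigma> \<in> cells K" "\<sigma> \<subseteq> A" and \<tau>: "\<tau> \<in> cells K"
    and inc: "incidence K \<sigma> \<tau> \<noteq> 0"
  shows "\<tau> \<subseteq> A"
proof (rule ccontr)
  assume not: "\<not> \<tau> \<subseteq> A"
  obtain S where S: "S \<subseteq> cells K" "A = \<Union>S" using A by (auto simp: cw_subcomplex_def)
  have disj: "x \<notin> \<tau>" if "x \<in> A" for x
  proof
    assume "x \<in> \<tau>"
    moreover obtain s where "s \<in> S" "x \<in> s" using \<open>x \<in> A\<close> S(2) by blast
    ultimately have "s = \<tau>" using cells_disjointD[OF _ \<tau>] S(1) by blast
    then show False using not S(2) \<open>s \<in> S\<close> by blast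
  qed
  have dim: "cdim K \<sigma> = Suc (cdim K \<tau>)" using inc by (auto simp: incidence_def split: if_splits)
  have "(collapse K \<tau> \<circ> charmap K \<sigma>) y = pinch_base" if y: "y \<in> topspace (nsphere (cdim K \<tau>))" for y
  proof -
    have "y \<in> closed_disc (cdim K \<sigma>)"
      using y disc_boundary_subset unfolding topspace_nsphere dim by blast
    then have "charmap K \<sigma> y \<in> A"
      using charmap_closed_disc_subset[OF \<sigma>(1) _ \<sigma>(2)] A by (auto simp: cw_subcomplex_def)
    then show ?thesis using disj by (simp add: collapse_def)
  qed
  then have "Brouwer_degree2 (cdim K \<tau>) (collapse K \<tau> \<circ> charmap K \<sigma>) = 0"
    using Brouwer_degree2_eq[of "cdim K \<tau>" _ "\<lambda>_. pinch_base"] by (simp add: Brouwer_degree2_const)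
  then show False using inc by (simp add: incidence_def split: if_splits)
qed

lemma finite_cells_in: "finite (cells_in K A q)"
  using finite_cells by (simp add: cells_in_def)

lemma cells_in_subset: "cells_in K A q \<subseteq> cells K"
  by (auto simp: cells_in_def)

lemma incidence_cells_in:
  assumes "cw_subcomplex K A" "\<sigma> \<in> cells_in K A (Suc q)" "\<tau> \<in> cells K" "incidence K \<sigma> \<tau> \<noteq> 0"
  shows "\<tau> \<in> cells_in K A q"
proof -
  have "cdim K \<sigma> = Suc (cdim K \<tau>)" using assms(4) by (auto simp: incidence_def split: if_splits)
  then show ?thesis using assms incidence_support[of A \<sigma> \<tau>] by (auto simp: cells_in_def)
qed

lemma chains_eq_0: "c \<in> chains K A q \<Longrightarrow> \<sigma> \<notin> cells_in K A q \<Longrightarrow> c \<sigma> = 0"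
  by (simp add: chains_def)

lemma chains_mono: "A \<subseteq> A' \<Longrightarrow> chains K A q \<subseteq> chains K A' q"
  by (auto simp: chains_def cells_in_def)

lemma function_subspace_chains: "function_subspace (chains K A q :: ('a, 'k::field) chain set)"
  by (auto simp: function_subspace_def chains_def)

lemma boundary_add: "boundary K (\<lambda>\<sigma>. c \<sigma> + d \<sigma>) = (\<lambda>\<tau>. boundary K c \<tau> + boundary K d \<tau>)"
  by (auto simp: boundary_def algebra_simps sum.distrib)

lemma boundary_scale: "boundary K (\<lambda>\<sigma>. a * c \<sigma>) = (\<lambda>\<tau>. a * boundary K c \<tau>)"
  by (auto simp: boundary_def algebra_simps sum_distrib_left)

lemma boundary_zero: "boundary K (\<lambda>_. 0) = (\<lambda>_. 0)"
  by (auto simp: boundary_def)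

lemma boundary_boundary: "boundary K (boundary K c) = (\<lambda>_. 0 :: 'k::field)"
proof
  fix \<rho>
  show "boundary K (boundary K c) \<rho> = (0 :: 'k)"
  proof (cases "\<rho> \<in> cells K")
    case True
    then have "boundary K (boundary K c) \<rho>
        = (\<Sum>\<tau>\<in>cells K. \<Sum>\<sigma>\<in>cells K. of_int (incidence K \<tau> \<rho>) * (of_int (incidence K \<sigma> \<tau>) * c \<sigma>))"
      by (simp add: boundary_def sum_distrib_left)
    also have "\<dots> = (\<Sum>\<sigma>\<in>cells K. \<Sum>\<tau>\<in>cells K. of_int (incidence K \<tau> \<rho>) * (of_int (incidence K \<sigma> \<tau>) * c \<sigma>))"
      by (rule sum.swap)
    also have "\<dots> = (\<Sum>\<sigma>\<in>cells K. of_int (\<Sum>\<tau>\<in>cells K. incidence K \<sigma> \<tau> * incidence K \<tau> \<rho>) * c \<sigma>)"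
      by (simp add: sum_distrib_left sum_distrib_right mult_ac)
    also have "\<dots> = 0" using True by (simp add: incidence_incidence)
    finally show ?thesis .
  qed (simp add: boundary_def)
qed

lemma boundary_chains:
  assumes A: "cw_subcomplex K A" and c: "c \<in> chains K A (Suc q)"
  shows "boundary K c \<in> chains K A q"
proof -
  have "boundary K c \<tau> = 0" if \<tau>: "\<tau> \<notin> cells_in K A q" for \<tau>
  proof (cases "\<tau> \<in> cells K")
    case True
    have "of_int (incidence K \<sigma> \<tau>) * c \<sigma> = 0" for \<sigma>
      using incidence_cells_in[OF A _ True] \<tau> chains_eq_0[OF c] by fastforce
    then show ?thesis by (simp add: boundary_def)
  qed (simp add: boundary_def)
  then show ?thesis by (simp add: chains_def)
qed

lemma function_subspace_cycles: "function_subspace (cycles K A q :: ('a, 'k::field) chain set)"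
  using function_subspaceD[OF function_subspace_chains[of A q]]
  by (auto simp: function_subspace_def cycles_def boundary_add boundary_scale boundary_zero)

lemma function_subspace_boundaries: "function_subspace (boundaries K A q :: ('a, 'k::field) chain set)"
proof -
  note D = function_subspaceD[OF function_subspace_chains[of A "Suc q"]]
  show ?thesis
    unfolding function_subspace_def boundaries_def
  proof (intro conjI ballI allI)
    show "(\<lambda>_. 0) \<in> boundary K ` chains K A (Suc q)"
      by (intro image_eqI[where x = "\<lambda>_. 0"]) (simp_all add: boundary_zero D(1))
  next
    fix x y :: "('a, 'k) chain" assume "x \<in> boundary K ` chains K A (Suc q)" "y \<in> boundary K ` chains K A (Suc q)"
    then obtain c d where "c \<in> chains K A (Suc q)" "d \<in> chains K A (Suc q)" "x = boundary K c" "y = boundary K d" by blast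
    then show "(\<lambda>i. x i + y i) \<in> boundary K ` chains K A (Suc q)"
      using D(2)[of c d] by (intro image_eqI[of _ _ "\<lambda>i. c i + d i"]) (simp_all add: boundary_add)
  next
    fix a and x :: "('a, 'k) chain" assume "x \<in> boundary K ` chains K A (Suc q)"
    then obtain c where "c \<in> chains K A (Suc q)" "x = boundary K c" by blast
    then show "(\<lambda>i. a * x i) \<in> boundary K ` chains K A (Suc q)"
      using D(3)[of c a] by (intro image_eqI[of _ _ "\<lambda>i. a * c i"]) (simp_all add: boundary_scale)
  qed
qed

lemma boundaries_subset_cycles: "cw_subcomplex K A \<Longrightarrow> boundaries K A q \<subseteq> cycles K A q"
  using boundary_chains by (auto simp: boundaries_def cycles_def boundary_boundary)

lemma boundaries_mono: "A \<subseteq> A' \<Longrightarrow> boundaries K A q \<subseteq> boundaries K A' q"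
  using chains_mono[of A A' "Suc q"] by (auto simp: boundaries_def)

lemma cycles_mono: "A \<subseteq> A' \<Longrightarrow> cycles K A q \<subseteq> cycles K A' q"
  using chains_mono[of A A' q] by (auto simp: cycles_def)

lemma cochain_eval_add_left:
  "cochain_eval K A q (\<lambda>\<sigma>. \<phi> \<sigma> + \<psi> \<sigma>) c = cochain_eval K A q \<phi> c + cochain_eval K A q \<psi> c"
  by (simp add: cochain_eval_def algebra_simps sum.distrib)

lemma cochain_eval_scale_left: "cochain_eval K A q (\<lambda>\<sigma>. a * \<phi> \<sigma>) c = a * cochain_eval K A q \<phi> c"
  by (simp add: cochain_eval_def sum_distrib_left mult.assoc)

lemma cochain_eval_add_right:
  "cochain_eval K A q \<phi> (\<lambda>\<sigma>. c \<sigma> + d \<sigma>) = cochain_eval K A q \<phi> c + cochain_eval K A q \<phi> d"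
  by (simp add: cochain_eval_def algebra_simps sum.distrib)

lemma cochain_eval_sum_right:
  "cochain_eval K A q \<phi> (\<lambda>\<sigma>. \<Sum>r\<in>S. a r * c r \<sigma>) = (\<Sum>r\<in>S. a r * cochain_eval K A q \<phi> (c r))"
proof -
  have "cochain_eval K A q \<phi> (\<lambda>\<sigma>. \<Sum>r\<in>S. a r * c r \<sigma>)
      = (\<Sum>\<sigma>\<in>cells_in K A q. \<Sum>r\<in>S. a r * (\<phi> \<sigma> * c r \<sigma>))"
    by (simp add: cochain_eval_def sum_distrib_left mult.left_commute)
  also have "\<dots> = (\<Sum>r\<in>S. \<Sum>\<sigma>\<in>cells_in K A q. a r * (\<phi> \<sigma> * c r \<sigma>))"
    by (rule sum.swap)
  finally show ?thesis by (simp add: cochain_eval_def sum_distrib_left)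
qed

lemma cochain_eval_zero_right: "cochain_eval K A q \<phi> (\<lambda>_. 0) = 0"
  by (simp add: cochain_eval_def)

lemma coboundary_apply:
  assumes "\<sigma> \<in> cells_in K A (Suc q)"
  shows "coboundary K A q \<phi> \<sigma> = (\<Sum>\<tau>\<in>cells_in K A q. \<phi> \<tau> * of_int (incidence K \<sigma> \<tau>))"
proof -
  have \<sigma>: "\<sigma> \<in> cells K" using assms by (simp add: cells_in_def)
  have "boundary K (\<lambda>\<tau>. if \<tau> = \<sigma> then 1 else 0) \<tau> = (of_int (incidence K \<sigma> \<tau>) :: 'b)"
    if "\<tau> \<in> cells_in K A q" for \<tau>
    using that \<sigma> finite_cells
    by (simp add: boundary_def cells_in_def if_distrib[where f = "\<lambda>x. _ * x"] cong: if_cong)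
  then show ?thesis using assms by (simp add: coboundary_def cochain_eval_def)
qed

lemma coboundary_in_chains: "coboundary K A q \<phi> \<in> chains K A (Suc q)"
  by (auto simp: coboundary_def chains_def)

lemma cochain_eval_boundary:
  assumes b: "b \<in> chains K A (Suc q)"
  shows "cochain_eval K A q \<phi> (boundary K b) = cochain_eval K A (Suc q) (coboundary K A q \<phi>) b"
proof -
  have "boundary K b \<tau> = (\<Sum>\<sigma>\<in>cells_in K A (Suc q). of_int (incidence K \<sigma> \<tau>) * b \<sigma>)"
    if "\<tau> \<in> cells_in K A q" for \<tau>
    using that finite_cells cells_in_subset chains_eq_0[OF b]
    by (auto simp: boundary_def intro!: sum.mono_neutral_right)
  then have "cochain_eval K A q \<phi> (boundary K b)
      = (\<Sum>\<tau>\<in>cells_in K A q. \<Sum>\<sigma>\<in>cells_in K A (Suc q). \<phi> \<tau> * (of_int (incidence K \<sigma> \<tau>) * b \<sigma>))"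
    by (simp add: cochain_eval_def sum_distrib_left)
  also have "\<dots> = (\<Sum>\<sigma>\<in>cells_in K A (Suc q). \<Sum>\<tau>\<in>cells_in K A q. \<phi> \<tau> * (of_int (incidence K \<sigma> \<tau>) * b \<sigma>))"
    by (rule sum.swap)
  also have "\<dots> = cochain_eval K A (Suc q) (coboundary K A q \<phi>) b"
    by (simp add: cochain_eval_def coboundary_apply sum_distrib_right mult.assoc)
  finally show ?thesis .
qed

lemma coboundary_add: "coboundary K A q (\<lambda>\<sigma>. \<phi> \<sigma> + \<psi> \<sigma>) = (\<lambda>\<tau>. coboundary K A q \<phi> \<tau> + coboundary K A q \<psi> \<tau>)"
  by (auto simp: coboundary_def cochain_eval_add_left)

lemma coboundary_scale: "coboundary K A q (\<lambda>\<sigma>. a * \<phi> \<sigma>) = (\<lambda>\<tau>. a * coboundary K A q \<phi> \<tau>)"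
  by (auto simp: coboundary_def cochain_eval_scale_left)

lemma coboundary_zero: "coboundary K A q (\<lambda>_. 0) = (\<lambda>_. 0)"
  using coboundary_scale[of A q 0 "\<lambda>_. 0"] by simp

lemma coboundary_coboundary:
  fixes \<phi> :: "('a, 'k::field) chain"
  assumes A: "cw_subcomplex K A"
  shows "coboundary K A (Suc q) (coboundary K A q \<phi>) = (\<lambda>_. 0)"
proof
  fix \<sigma>
  show "coboundary K A (Suc q) (coboundary K A q \<phi>) \<sigma> = 0"
  proof (cases "\<sigma> \<in> cells_in K A (Suc (Suc q))")
    case True
    let ?e = "\<lambda>\<tau>. if \<tau> = \<sigma> then 1 else 0 :: 'k"
    have "?e \<in> chains K A (Suc (Suc q))" using True by (auto simp: chains_def)
    then have "boundary K ?e \<in> chains K A (Suc q)" by (rule boundary_chains[OF A])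
    then have "coboundary K A (Suc q) (coboundary K A q \<phi>) \<sigma> = cochain_eval K A q \<phi> (boundary K (boundary K ?e))"
      using True by (simp add: coboundary_def[of K A "Suc q"] cochain_eval_boundary)
    then show ?thesis by (simp add: boundary_boundary cochain_eval_zero_right)
  qed (simp add: coboundary_def)
qed

lemma function_subspace_cocycles: "function_subspace (cocycles K A q :: ('a, 'k::field) chain set)"
  using function_subspaceD[OF function_subspace_chains[of A q]]
  by (auto simp: function_subspace_def cocycles_def coboundary_add coboundary_scale coboundary_zero)

lemma function_subspace_coboundaries: "function_subspace (coboundaries K A q :: ('a, 'k::field) chain set)"
proof (cases q)
  case 0
  then show ?thesis by (auto simp: coboundaries_def function_subspace_def)
next
  case (Suc p)
  note D = function_subspaceD[OF function_subspace_chains[of A p]]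
  have "function_subspace (coboundary K A p ` chains K A p :: ('a, 'k) chain set)"
    unfolding function_subspace_def
  proof (intro conjI ballI allI)
    show "(\<lambda>_. 0) \<in> coboundary K A p ` chains K A p"
      by (intro image_eqI[where x = "\<lambda>_. 0"]) (simp_all add: coboundary_zero D(1))
  next
    fix x y :: "('a, 'k) chain" assume "x \<in> coboundary K A p ` chains K A p" "y \<in> coboundary K A p ` chains K A p"
    then obtain c d where "c \<in> chains K A p" "d \<in> chains K A p" "x = coboundary K A p c" "y = coboundary K A p d" by blast
    then show "(\<lambda>i. x i + y i) \<in> coboundary K A p ` chains K A p"
      using D(2)[of c d] by (intro image_eqI[of _ _ "\<lambda>i. c i + d i"]) (simp_all add: coboundary_add)
  next
    fix a and x :: "('a, 'k) chain" assume "x \<in> coboundary K A p ` chains K A p"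
    then obtain c where "c \<in> chains K A p" "x = coboundary K A p c" by blast
    then show "(\<lambda>i. a * x i) \<in> coboundary K A p ` chains K A p"
      using D(3)[of c a] by (intro image_eqI[of _ _ "\<lambda>i. a * c i"]) (simp_all add: coboundary_scale)
  qed
  then show ?thesis using Suc by (simp add: coboundaries_def)
qed

lemma coboundaries_subset_cocycles:
  assumes "cw_subcomplex K A" shows "coboundaries K A q \<subseteq> cocycles K A q"
proof (cases q)
  case 0
  then show ?thesis
    using function_subspaceD(1)[OF function_subspace_cocycles[of A 0]] by (auto simp: coboundaries_def)
next
  case (Suc p)
  then show ?thesis
    using coboundary_coboundary[OF assms] coboundary_in_chains
    by (auto simp: coboundaries_def cocycles_def)
qed

lemma hom_class_eq: "hom_class K A q c = coset (boundaries K A q) c"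
  by (simp add: hom_class_def r_coset_fun_module)

lemma cohom_class_eq: "cohom_class K A q \<phi> = coset (coboundaries K A q) \<phi>"
  by (simp add: cohom_class_def r_coset_fun_module)

lemma kronecker_class:
  fixes \<phi> c :: "('a, 'k::field) chain"
  assumes A: "cw_subcomplex K A" and \<phi>: "\<phi> \<in> cocycles K A q" and c: "c \<in> cycles K A q"
  shows "kronecker K A q (cohom_class K A q \<phi>) (hom_class K A q c) = cochain_eval K A q \<phi> c"
proof -
  have eval_boundary: "cochain_eval K A q \<psi> b = 0"
    if "\<psi> \<in> cocycles K A q" "b \<in> boundaries K A q" for \<psi> b :: "('a, 'k) chain"
    using that by (auto simp: boundaries_def cocycles_def cochain_eval_boundary)
      (simp add: cochain_eval_def)
  have eval_coboundary: "cochain_eval K A q \<beta> x = 0"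
    if "\<beta> \<in> coboundaries K A q" "x \<in> cycles K A q" for \<beta> x :: "('a, 'k) chain"
  proof (cases q)
    case 0
    then show ?thesis using that by (simp add: coboundaries_def cochain_eval_def)
  next
    case (Suc p)
    from that(1) obtain \<psi> where "\<beta> = coboundary K A p \<psi>" by (auto simp: coboundaries_def Suc)
    then show ?thesis
      using that(2) Suc cochain_eval_boundary[of x A p \<psi>] by (simp add: cycles_def cochain_eval_zero_right)
  qed
  have "cochain_eval K A q \<psi> x = cochain_eval K A q \<phi> c"
    if "\<psi> \<in> cohom_class K A q \<phi>" "x \<in> hom_class K A q c" for \<psi> x
  proof -
    let ?\<beta> = "\<lambda>\<sigma>. \<psi> \<sigma> - \<phi> \<sigma>" and ?b = "\<lambda>\<sigma>. x \<sigma> - c \<sigma>"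
    have \<beta>: "?\<beta> \<in> coboundaries K A q" and b: "?b \<in> boundaries K A q"
      using that by (simp_all add: hom_class_eq cohom_class_eq coset_def)
    have "?b \<in> cycles K A q" using b boundaries_subset_cycles[OF A] by blast
    then have x: "x \<in> cycles K A q"
      using function_subspaceD(2)[OF function_subspace_cycles[of A q], of ?b c] c by simp
    have "cochain_eval K A q \<psi> x = cochain_eval K A q \<phi> x + cochain_eval K A q ?\<beta> x"
      using cochain_eval_add_left[of A q \<phi> ?\<beta> x] by simp
    also have "\<dots> = cochain_eval K A q \<phi> c + cochain_eval K A q \<phi> ?b"
      using cochain_eval_add_right[of A q \<phi> c ?b] eval_coboundary[OF \<beta> x] by simp
    finally show ?thesis using eval_boundary[OF \<phi> b] by simp
  qed
  moreover have "\<phi> \<in> cohom_class K A q \<phi>" "c \<in> hom_class K A q c"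
    by (simp_all add: hom_class_eq cohom_class_eq coset_self function_subspace_boundaries
        function_subspace_coboundaries)
  ultimately have "(\<forall>\<psi>\<in>cohom_class K A q \<phi>. \<forall>x\<in>hom_class K A q c. cochain_eval K A q \<psi> x = a) \<longleftrightarrow>
      a = cochain_eval K A q \<phi> c" for a
    by metis
  then show ?thesis by (simp add: kronecker_def)
qed

lemma incl_homology_class:
  assumes "A \<subseteq> A'"
  shows "incl_homology K A' q (hom_class K A q c) = hom_class K A' q c"
proof -
  have "coset (boundaries K A' q) x = coset (boundaries K A' q) c" if "x \<in> hom_class K A q c" for x
    using that boundaries_mono[OF assms]
    by (subst coset_eq_iff[OF function_subspace_boundaries]) (auto simp: hom_class_eq coset_def)
  moreover have "c \<in> hom_class K A q c"
    by (simp add: hom_class_eq coset_self function_subspace_boundaries)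
  ultimately show ?thesis unfolding incl_homology_def hom_class_eq[of A'] by blast
qed

lemma restrict_cochain_in_chains: "restrict_cochain K A q \<phi> \<in> chains K A q"
  by (simp add: restrict_cochain_def chains_def)

lemma coboundary_restrict_cochain:
  assumes A: "cw_subcomplex K A" and AA': "A \<subseteq> A'"
  shows "coboundary K A q (restrict_cochain K A q \<phi>) = restrict_cochain K A (Suc q) (coboundary K A' q \<phi>)"
proof
  fix \<sigma>
  show "coboundary K A q (restrict_cochain K A q \<phi>) \<sigma> = restrict_cochain K A (Suc q) (coboundary K A' q \<phi>) \<sigma>"
  proof (cases "\<sigma> \<in> cells_in K A (Suc q)")
    case True
    then have \<sigma>': "\<sigma> \<in> cells_in K A' (Suc q)" using AA' by (auto simp: cells_in_def)
    have "coboundary K A q (restrict_cochain K A q \<phi>) \<sigma>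
        = (\<Sum>\<tau>\<in>cells_in K A q. \<phi> \<tau> * of_int (incidence K \<sigma> \<tau>))"
      by (simp add: coboundary_apply[OF True] restrict_cochain_def)
    also have "\<dots> = (\<Sum>\<tau>\<in>cells_in K A' q. \<phi> \<tau> * of_int (incidence K \<sigma> \<tau>))"
    proof (rule sum.mono_neutral_left)
      show "cells_in K A q \<subseteq> cells_in K A' q" using AA' by (auto simp: cells_in_def)
      show "\<forall>\<tau>\<in>cells_in K A' q - cells_in K A q. \<phi> \<tau> * of_int (incidence K \<sigma> \<tau>) = 0"
        using incidence_cells_in[OF A True] cells_in_subset by fastforce
    qed (rule finite_cells_in)
    also have "\<dots> = restrict_cochain K A (Suc q) (coboundary K A' q \<phi>) \<sigma>"
      using True by (simp add: restrict_cochain_def coboundary_apply[OF \<sigma>'])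
    finally show ?thesis .
  qed (simp add: coboundary_def restrict_cochain_def)
qed

lemma restrict_cochain_cocycles:
  assumes "cw_subcomplex K A" "A \<subseteq> A'" "\<phi> \<in> cocycles K A' q"
  shows "restrict_cochain K A q \<phi> \<in> cocycles K A q"
  using assms(3)
  by (simp add: cocycles_def restrict_cochain_in_chains coboundary_restrict_cochain[OF assms(1,2)])
    (simp add: restrict_cochain_def)

lemma restrict_cochain_coboundaries:
  assumes "cw_subcomplex K A" "A \<subseteq> A'" "\<beta> \<in> coboundaries K A' q"
  shows "restrict_cochain K A q \<beta> \<in> coboundaries K A q"
proof (cases q)
  case 0
  then show ?thesis using assms(3) by (auto simp: coboundaries_def restrict_cochain_def)
next
  case (Suc p)
  then obtain \<psi> where "\<beta> = coboundary K A' p \<psi>" using assms(3) by (auto simp: coboundaries_def)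
  then have "restrict_cochain K A q \<beta> = coboundary K A p (restrict_cochain K A p \<psi>)"
    using Suc by (simp add: coboundary_restrict_cochain[OF assms(1,2)])
  then show ?thesis using Suc restrict_cochain_in_chains by (auto simp: coboundaries_def)
qed

lemma incl_cohomology_class:
  assumes "cw_subcomplex K A" "A \<subseteq> A'"
  shows "incl_cohomology K A q (cohom_class K A' q \<phi>) = cohom_class K A q (restrict_cochain K A q \<phi>)"
proof -
  have "coset (coboundaries K A q) (restrict_cochain K A q \<psi>) = coset (coboundaries K A q) (restrict_cochain K A q \<phi>)"
    if "\<psi> \<in> cohom_class K A' q \<phi>" for \<psi>
  proof -
    have "(\<lambda>\<sigma>. \<psi> \<sigma> - \<phi> \<sigma>) \<in> coboundaries K A' q"
      using that by (simp add: cohom_class_eq coset_def)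
    from restrict_cochain_coboundaries[OF assms this]
    show ?thesis
      by (subst coset_eq_iff[OF function_subspace_coboundaries])
        (simp add: restrict_cochain_def if_distrib cong: if_cong)
  qed
  moreover have "\<phi> \<in> cohom_class K A' q \<phi>"
    by (simp add: cohom_class_eq coset_self function_subspace_coboundaries)
  ultimately show ?thesis
    unfolding incl_cohomology_def restrict_cochain_def[symmetric] cohom_class_eq[of A] by blast
qed

lemma cochain_eval_restrict_cochain:
  assumes "A \<subseteq> A'" "c \<in> chains K A q"
  shows "cochain_eval K A q (restrict_cochain K A q \<phi>) c = cochain_eval K A' q \<phi> c"
proof -
  have "cochain_eval K A q (restrict_cochain K A q \<phi>) c = (\<Sum>\<sigma>\<in>cells_in K A q. \<phi> \<sigma> * c \<sigma>)"
    by (simp add: cochain_eval_def restrict_cochain_def)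
  also have "\<dots> = cochain_eval K A' q \<phi> c"
    unfolding cochain_eval_def
    using assms chains_eq_0[OF assms(2)] finite_cells_in
    by (intro sum.mono_neutral_left) (auto simp: cells_in_def)
  finally show ?thesis .
qed

lemma quotient_function_space_homology:
  "cw_subcomplex K A \<Longrightarrow> quotient_function_space (cycles K A q) (boundaries K A q)"
  by (simp add: quotient_function_space_def function_subspace_cycles function_subspace_boundaries
      boundaries_subset_cycles)

lemma quotient_function_space_cohomology:
  "cw_subcomplex K A \<Longrightarrow> quotient_function_space (cocycles K A q) (coboundaries K A q)"
  by (simp add: quotient_function_space_def function_subspace_cocycles function_subspace_coboundaries
      coboundaries_subset_cocycles)

end

section \<open>Reduced matrices and surviving classes\<close>

lemma low_nonzero_col:
  assumes "\<not> zero_col R j" "R \<in> carrier_mat N M" "j < M"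
  shows "low (col R j) < N" "R $$ (low (col R j), j) \<noteq> 0"
    "\<lbrakk>low (col R j) < r; r < N\<rbrakk> \<Longrightarrow> R $$ (r, j) = 0"
proof -
  let ?L = "{i. i < dim_vec (col R j) \<and> col R j $ i \<noteq> 0}"
  have L: "?L = {i. i < N \<and> R $$ (i, j) \<noteq> 0}" using assms by auto
  have fin: "finite ?L" by simp
  have "?L \<noteq> {}"
  proof
    assume "?L = {}"
    then have "col R j = 0\<^sub>v (dim_row R)" by (intro eq_vecI) auto
    then show False using assms(1) by (simp add: zero_col_def)
  qed
  then have "low (col R j) \<in> ?L" unfolding low_def by (rule Max_in[OF fin])
  then show "low (col R j) < N" "R $$ (low (col R j), j) \<noteq> 0" unfolding L by auto
  show "R $$ (r, j) = 0" if "low (col R j) < r" "r < N"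
  proof (rule ccontr)
    assume "R $$ (r, j) \<noteq> 0"
    then have "r \<in> ?L" unfolding L using that by simp
    then have "r \<le> low (col R j)" unfolding low_def by (rule Max_ge[OF fin])
    then show False using that by simp
  qed
qed

lemma zero_col_entry:
  assumes "zero_col R j" "R \<in> carrier_mat N M" "j < M" "r < N"
  shows "R $$ (r, j) = 0"
proof -
  have "col R j $ r = 0\<^sub>v (dim_row R) $ r" using assms(1) by (simp add: zero_col_def)
  then show ?thesis using assms(2-) by simp
qed

text \<open>In a linear combination of columns with pairwise distinct lows no cancellation occurs at the
  largest low.\<close>

lemma reduced_combination_low:
  fixes R :: "'k::field mat"
  assumes R: "R \<in> carrier_mat N N" and red: "reduced R"
    and v: "v < N" "(\<Sum>i<N. R $$ (v, i) * x i) \<noteq> 0"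
    and above: "\<And>r. \<lbrakk>v < r; r < N\<rbrakk> \<Longrightarrow> (\<Sum>i<N. R $$ (r, i) * x i) = 0"
  obtains j where "j < N" "x j \<noteq> 0" "\<not> zero_col R j" "low (col R j) = v"
proof -
  let ?J = "{j. j < N \<and> x j \<noteq> 0 \<and> \<not> zero_col R j}"
  let ?low = "\<lambda>j. low (col R j)"
  note lowR = low_nonzero_col[OF _ R]
  have off: "R $$ (r, j) * x j = 0" if "j < N" "r < N" "j \<in> ?J \<Longrightarrow> ?low j < r" for r j
    using that zero_col_entry[OF _ R] lowR(3)[of j r] by (cases "j \<in> ?J") auto
  have "?J \<noteq> {}"
  proof
    assume "?J = {}"
    then have "(\<Sum>i<N. R $$ (v, i) * x i) = 0" using off v(1) by (intro sum.neutral) blast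
    then show False using v(2) by simp
  qed
  then have "Max (?low ` ?J) \<in> ?low ` ?J" by (intro Max_in) auto
  then obtain j where j: "j \<in> ?J" "?low j = Max (?low ` ?J)" by auto
  have max: "?low i \<le> ?low j" if "i \<in> ?J" for i
    unfolding j(2) using that by (intro Max_ge) auto
  have jN: "j < N" "\<not> zero_col R j" "x j \<noteq> 0" using j(1) by auto
  have "(\<Sum>i<N. R $$ (?low j, i) * x i) = R $$ (?low j, j) * x j"
  proof -
    have "R $$ (?low j, i) * x i = 0" if "i \<in> {..<N} - {j}" for i
    proof (rule off)
      assume "i \<in> ?J"
      then have "?low i \<noteq> ?low j" using red that jN R by (auto simp: reduced_def)
      then show "?low i < ?low j" using max[OF \<open>i \<in> ?J\<close>] by simp
    qed (use that lowR(1)[OF jN(2,1)] in auto)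
    then have "(\<Sum>i\<in>{..<N} - {j}. R $$ (?low j, i) * x i) = 0" by (rule sum.neutral[rule_format])
    then show ?thesis using jN(1) by (simp add: sum.remove[of "{..<N}" j])
  qed
  then have "(\<Sum>i<N. R $$ (?low j, i) * x i) \<noteq> 0" using lowR(2)[OF jN(2,1)] jN(3) by simp
  then have "?low j \<le> v" using above[of "?low j"] lowR(1)[OF jN(2,1)] by fastforce
  moreover have "\<not> ?low j < v"
  proof
    assume "?low j < v"
    then have "(\<Sum>i<N. R $$ (v, i) * x i) = 0"
      using off[OF _ v(1)] max by (intro sum.neutral) (metis (no_types, lifting) le_less_trans lessThan_iff)
    then show False using v(2) by simp
  qed
  ultimately show thesis using that[OF jN(1,3,2)] by simp
qed

lemma pair_eq_Some:
  assumes "reduced R" "j < dim_col R" "\<not> zero_col R j" "low (col R j) = i"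
  shows "pair R i = Some j"
proof -
  have "(THE j. j < dim_col R \<and> \<not> zero_col R j \<and> low (col R j) = i) = j"
    using assms by (intro the_equality) (auto simp: reduced_def)
  then show ?thesis using assms by (auto simp: pair_def)
qed

lemma unitriangular_combination:
  fixes V :: "'k::field mat"
  assumes V: "V \<in> carrier_mat N N" "upper_triangular V" "\<And>i. i < N \<Longrightarrow> V $$ (i, i) = 1"
    and down: "\<And>i j. \<lbrakk>i \<le> j; j < N; P j\<rbrakk> \<Longrightarrow> P i"
    and supp: "\<And>j. \<lbrakk>j < N; y j \<noteq> 0\<rbrakk> \<Longrightarrow> P j"
  obtains x where "\<And>j. \<lbrakk>j < N; x j \<noteq> 0\<rbrakk> \<Longrightarrow> P j"
    "\<And>j. j < N \<Longrightarrow> y j = (\<Sum>i<N. V $$ (j, i) * x i)"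
proof -
  have V0: "V $$ (j, i) = 0" if "i < j" "j < N" for i j
    using V(1,2) that by (auto simp: upper_triangular_def)
  have "\<exists>x. (\<forall>j<N. x j \<noteq> 0 \<longrightarrow> P j) \<and> (\<forall>j<N. y j = (\<Sum>i<N. V $$ (j, i) * x i))"
    if "p \<le> N" "\<And>j. \<lbrakk>j < N; y j \<noteq> 0\<rbrakk> \<Longrightarrow> j < p \<and> P j" for p y
    using that
  proof (induction p arbitrary: y)
    case 0
    then show ?case by (intro exI[of _ "\<lambda>_. 0"]) auto
  next
    case (Suc p)
    then have p: "p < N" by simp
    define y' where "y' j = y j - V $$ (j, p) * y p" for j
    have "j < p \<and> P j" if j: "j < N" "y' j \<noteq> 0" for j
    proof -
      have "j \<le> p"
        using j V0[of p j] Suc.prems(2)[OF j(1)] by (cases "j \<le> p") (auto simp: y'_def)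
      moreover have "j \<noteq> p" using j V(3)[of p] by (auto simp: y'_def)
      moreover have "P j"
      proof (cases "y j = 0")
        case True
        then have "y p \<noteq> 0" using j(2) by (auto simp: y'_def)
        then show ?thesis using Suc.prems(2)[OF p] down[OF \<open>j \<le> p\<close> p] by blast
      qed (use Suc.prems(2) j(1) in blast)
      ultimately show ?thesis by simp
    qed
    then obtain x where x: "\<And>j. \<lbrakk>j < N; x j \<noteq> 0\<rbrakk> \<Longrightarrow> P j"
      "\<And>j. j < N \<Longrightarrow> y' j = (\<Sum>i<N. V $$ (j, i) * x i)"
      using Suc.IH[of y'] p by (metis less_imp_le)
    define x' where "x' i = x i + (if i = p then y p else 0)" for i
    have "y j = (\<Sum>i<N. V $$ (j, i) * x' i)" if "j < N" for j
    proof -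
      have "(\<Sum>i<N. V $$ (j, i) * x' i)
          = (\<Sum>i<N. V $$ (j, i) * x i) + (\<Sum>i<N. if i = p then V $$ (j, i) * y p else 0)"
        by (simp add: x'_def algebra_simps sum.distrib if_distrib[where f = "\<lambda>z. _ * z"] cong: if_cong)
      then show ?thesis using x(2)[OF that] p by (simp add: y'_def algebra_simps)
    qed
    moreover have "P j" if "j < N" "x' j \<noteq> 0" for j
      using that x(1)[of j] Suc.prems(2)[OF p] by (cases "j = p"; cases "y p = 0") (auto simp: x'_def)
    ultimately show ?case by blast
  qed
  from this[of N y] show thesis using supp that by auto
qed

context filtered_cw_complex
begin

abbreviation N :: nat where "N \<equiv> card (cells K)"

lemma cell_in_cells: "i < N \<Longrightarrow> cell i \<in> cells K"
  using bij_betwE[OF enumeration] by blast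

lemma cell_cases: "\<sigma> \<in> cells K \<Longrightarrow> (\<And>i. \<lbrakk>i < N; \<sigma> = cell i\<rbrakk> \<Longrightarrow> thesis) \<Longrightarrow> thesis"
  using bij_betw_imp_surj_on[OF enumeration] by blast

lemma cell_inj: "\<lbrakk>i < N; j < N; cell i = cell j\<rbrakk> \<Longrightarrow> i = j"
  using bij_betw_imp_inj_on[OF enumeration] by (auto dest: inj_onD)

lemma f_cell_mono: "\<lbrakk>i \<le> j; j < N\<rbrakk> \<Longrightarrow> f (cell i) \<le> f (cell j)"
  using order_filtration[of j i] by fastforce

lemma cells_in_Union:
  assumes "S \<subseteq> cells K" shows "cells_in K (\<Union>S) q = {\<sigma> \<in> S. cdim K \<sigma> = q}"
proof -
  have "\<sigma> \<in> S" if \<sigma>: "\<sigma> \<in> cells K" "\<sigma> \<subseteq> \<Union>S" for \<sigma>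
  proof -
    obtain x where "x \<in> \<sigma>" using cell_nonempty[OF \<sigma>(1)] by blast
    moreover obtain \<tau> where "\<tau> \<in> S" "x \<in> \<tau>" using \<sigma>(2) \<open>x \<in> \<sigma>\<close> by blast
    ultimately show ?thesis using cells_disjointD[OF \<sigma>(1), of \<tau> x] assms by blast
  qed
  then show ?thesis using assms by (auto simp: cells_in_def)
qed

lemma cells_in_sublevel: "cells_in K (sublevel K f t) q = {\<sigma> \<in> cells K. f \<sigma> \<le> t \<and> cdim K \<sigma> = q}"
  unfolding sublevel_def by (subst cells_in_Union) auto

lemma cells_in_strict_sublevel: "cells_in K (strict_sublevel K f t) q = {\<sigma> \<in> cells K. f \<sigma> < t \<and> cdim K \<sigma> = q}"
  unfolding strict_sublevel_def by (subst cells_in_Union) auto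

lemma strict_sublevel_subset: "strict_sublevel K f t \<subseteq> sublevel K f t"
  by (force simp: strict_sublevel_def sublevel_def)

lemma birth_cycle_cell:
  assumes "V \<in> carrier_mat N N" "i < N" "j < N"
  shows "birth_cycle cell V i (cell j) = V $$ (j, i)"
proof -
  have "birth_cycle cell V i (cell j) = (\<Sum>l<N. if l = j then V $$ (l, i) else 0)"
    unfolding birth_cycle_def chain_of_vec_def using assms cell_inj by (intro sum.cong) auto
  then show ?thesis using assms by simp
qed

lemma birth_cycle_outside:
  assumes "V \<in> carrier_mat N N" "\<sigma> \<notin> cells K"
  shows "birth_cycle cell V i \<sigma> = 0"
  unfolding birth_cycle_def chain_of_vec_def
  using assms cell_in_cells by (intro sum.neutral) auto

lemma boundary_cell:
  assumes "r < N"
  shows "boundary K b (cell r) = (\<Sum>j<N. of_int (incidence K (cell j) (cell r)) * b (cell j))"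
  using assms cell_in_cells
  by (simp add: boundary_def sum.reindex_bij_betw[OF enumeration, symmetric])

lemma boundary_outside: "\<sigma> \<notin> cells K \<Longrightarrow> boundary K b \<sigma> = 0"
  by (simp add: boundary_def)

lemma reductionD:
  assumes "reduction K cell R V"
  shows "V \<in> carrier_mat N N" "R \<in> carrier_mat N N" "reduced R" "upper_triangular V"
    "\<And>i. i < N \<Longrightarrow> V $$ (i, i) = 1"
    "\<And>i j. \<lbrakk>i < j; j < N\<rbrakk> \<Longrightarrow> V $$ (j, i) = 0"
    "\<And>i j. \<lbrakk>i < N; j < N; V $$ (j, i) \<noteq> 0\<rbrakk> \<Longrightarrow> cdim K (cell j) = cdim K (cell i)"
    "\<And>r i. \<lbrakk>r < N; i < N\<rbrakk> \<Longrightarrow> R $$ (r, i) = (\<Sum>j<N. of_int (incidence K (cell j) (cell r)) * V $$ (j, i))"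
proof -
  note red = assms[unfolded reduction_def]
  show "V \<in> carrier_mat N N" "reduced R" "upper_triangular V" "\<And>i. i < N \<Longrightarrow> V $$ (i, i) = 1"
    "\<And>i j. \<lbrakk>i < N; j < N; V $$ (j, i) \<noteq> 0\<rbrakk> \<Longrightarrow> cdim K (cell j) = cdim K (cell i)"
    using red by blast+
  note V = this
  show "V $$ (j, i) = 0" if "i < j" "j < N" for i j
    using upper_triangularD[OF V(3) that(1)] that(2) carrier_matD(1)[OF V(1)] by simp
  show "R \<in> carrier_mat N N"
    using red V(1) by (metis boundary_matrix_def mat_carrier mult_carrier_mat)
  show "R $$ (r, i) = (\<Sum>j<N. of_int (incidence K (cell j) (cell r)) * V $$ (j, i))" if "r < N" "i < N" for r i
  proof -
    have "dim_row V = N" "dim_col V = N" using V(1) by auto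
    moreover have "R = boundary_matrix K cell * V" using red by blast
    ultimately show ?thesis
      using that by (simp add: boundary_matrix_def scalar_prod_def lessThan_atLeast0)
  qed
qed

lemma birth_cycle_in_cycles:
  assumes red: "reduction K cell R V" and i: "i < N" "zero_col R i" "cdim K (cell i) = q"
    and A: "\<And>j. \<lbrakk>j \<le> i; cdim K (cell j) = q\<rbrakk> \<Longrightarrow> cell j \<in> cells_in K A q"
  shows "birth_cycle cell V i \<in> cycles K A q"
proof -
  note D = reductionD[OF red]
  have "birth_cycle cell V i \<sigma> = 0" if \<sigma>: "\<sigma> \<notin> cells_in K A q" for \<sigma>
  proof (cases "\<sigma> \<in> cells K")
    case True
    then obtain j where j: "j < N" "\<sigma> = cell j" by (rule cell_cases)
    have "V $$ (j, i) = 0"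
      using A[of j] \<sigma> D(6)[of i j] D(7)[OF i(1) j(1)] i(3) j by (cases "j \<le> i") auto
    then show ?thesis using j birth_cycle_cell[OF D(1) i(1) j(1)] by simp
  qed (rule birth_cycle_outside[OF D(1)])
  moreover have "boundary K (birth_cycle cell V i) \<sigma> = 0" for \<sigma>
  proof (cases "\<sigma> \<in> cells K")
    case True
    then obtain r where r: "r < N" "\<sigma> = cell r" by (rule cell_cases)
    have "boundary K (birth_cycle cell V i) (cell r) = R $$ (r, i)"
      using r i(1) by (simp add: boundary_cell birth_cycle_cell[OF D(1) i(1)] D(8))
    then show ?thesis using zero_col_entry[OF i(2) D(2) i(1) r(1)] r(2) by simp
  qed (rule boundary_outside)
  ultimately show ?thesis by (auto simp: cycles_def chains_def)
qed

lemma birth_cycle_sublevel: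
  assumes "reduction K cell R V" "i \<in> intervals K f cell R q" "f (cell i) \<le> t"
  shows "birth_cycle cell V i \<in> cycles K (sublevel K f t) q"
  using assms
proof (intro birth_cycle_in_cycles)
  show "cell j \<in> cells_in K (sublevel K f t) q" if "j \<le> i" "cdim K (cell j) = q" for j
    using that assms(2,3) f_cell_mono[of j i] cell_in_cells[of j]
    by (auto simp: cells_in_sublevel intervals_def)
qed (auto simp: intervals_def)

lemma birth_cycle_strict_sublevel:
  assumes "reduction K cell R V" "i \<in> intervals K f cell R q" "f (cell i) < t"
  shows "birth_cycle cell V i \<in> cycles K (strict_sublevel K f t) q"
  using assms
proof (intro birth_cycle_in_cycles)
  show "cell j \<in> cells_in K (strict_sublevel K f t) q" if "j \<le> i" "cdim K (cell j) = q" for j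
    using that assms(2,3) f_cell_mono[of j i] cell_in_cells[of j]
    by (auto simp: cells_in_strict_sublevel intervals_def)
qed (auto simp: intervals_def)

lemma surviving_class_less:
  assumes red: "reduction K cell R V" and r: "r \<in> surviving K f cell R q t"
    and v: "v \<in> surviving K f cell R q t" and "r < v"
  shows "hom_class K (sublevel K f t) q (birth_cycle cell V r) \<noteq> hom_class K (sublevel K f t) q (birth_cycle cell V v)"
proof
  note D = reductionD[OF red]
  let ?z = "birth_cycle cell V"
  have rv: "r < N" "v < N" using r v by (auto simp: surviving_def intervals_def)
  assume "hom_class K (sublevel K f t) q (?z r) = hom_class K (sublevel K f t) q (?z v)"
  then have "(\<lambda>\<sigma>. ?z r \<sigma> - ?z v \<sigma>) \<in> boundaries K (sublevel K f t) q"
    by (simp add: hom_class_eq coset_eq_iff[OF function_subspace_boundaries])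
  then obtain b where b: "b \<in> chains K (sublevel K f t) (Suc q)" "boundary K b = (\<lambda>\<sigma>. ?z r \<sigma> - ?z v \<sigma>)"
    by (auto simp: boundaries_def)
  obtain x where x: "\<And>j. \<lbrakk>j < N; x j \<noteq> 0\<rbrakk> \<Longrightarrow> f (cell j) \<le> t"
    "\<And>j. j < N \<Longrightarrow> b (cell j) = (\<Sum>i<N. V $$ (j, i) * x i)"
  proof (rule unitriangular_combination[OF D(1,4,5)])
    show "f (cell i) \<le> t" if "i \<le> j" "j < N" "f (cell j) \<le> t" for i j
      using f_cell_mono[OF that(1,2)] that(3) by simp
    show "f (cell j) \<le> t" if "j < N" "b (cell j) \<noteq> 0" for j
      using chains_eq_0[OF b(1), of "cell j"] that(2) by (auto simp: cells_in_sublevel)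
  qed (assumption | rule that)+
  have comb: "(\<Sum>i<N. R $$ (s, i) * x i) = V $$ (s, r) - V $$ (s, v)" if s: "s < N" for s
  proof -
    have "(\<Sum>i<N. R $$ (s, i) * x i)
        = (\<Sum>i<N. \<Sum>j<N. of_int (incidence K (cell j) (cell s)) * (V $$ (j, i) * x i))"
      using s by (simp add: D(8) sum_distrib_right mult.assoc)
    also have "\<dots> = (\<Sum>j<N. \<Sum>i<N. of_int (incidence K (cell j) (cell s)) * (V $$ (j, i) * x i))"
      by (rule sum.swap)
    also have "\<dots> = boundary K b (cell s)"
      using s by (simp add: boundary_cell x(2) sum_distrib_left)
    also have "\<dots> = V $$ (s, r) - V $$ (s, v)"
      using s rv by (simp add: b(2) birth_cycle_cell[OF D(1)])
    finally show ?thesis .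
  qed
  obtain j where j: "j < N" "x j \<noteq> 0" "\<not> zero_col R j" "low (col R j) = v"
  proof (rule reduced_combination_low[OF D(2,3) rv(2)])
    show "(\<Sum>i<N. R $$ (v, i) * x i) \<noteq> 0"
      using comb[OF rv(2)] D(5)[OF rv(2)] D(6)[OF \<open>r < v\<close> rv(2)] by simp
    show "(\<Sum>i<N. R $$ (s, i) * x i) = 0" if "v < s" "s < N" for s
      using comb[OF that(2)] D(6)[of v s] D(6)[of r s] that \<open>r < v\<close> by simp
  qed (rule that)
  have "pair R v = Some j"
    using pair_eq_Some[OF D(3) _ j(3,4)] j(1) D(2) by auto
  then show False
    using v x(1)[OF j(1,2)] by (simp add: surviving_def death_def)
qed

lemma inj_on_surviving_class:
  assumes "reduction K cell R V"
  shows "inj_on (\<lambda>r. hom_class K (sublevel K f t) q (birth_cycle cell V r)) (surviving K f cell R q t)"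
proof (rule inj_onI, rule ccontr)
  fix r v
  assume "r \<in> surviving K f cell R q t" "v \<in> surviving K f cell R q t" "r \<noteq> v"
    "hom_class K (sublevel K f t) q (birth_cycle cell V r) = hom_class K (sublevel K f t) q (birth_cycle cell V v)"
  then show False
    using surviving_class_less[OF assms, of r q t v] surviving_class_less[OF assms, of v q t r]
    by (cases "r < v") auto
qed

lemma kronecker_finsum:
  fixes \<phi> :: "('a, 'k::field) chain"
  assumes A: "cw_subcomplex K A" and \<phi>: "\<phi> \<in> cocycles K A q"
    and z: "\<And>r. r \<in> S \<Longrightarrow> z r \<in> cycles K A q"
  shows "kronecker K A q (cohom_class K A q \<phi>)
      (finsum (homology K A q) (\<lambda>r. a r \<odot>\<^bsub>homology K A q\<^esub> hom_class K A q (z r)) S)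
    = (\<Sum>r\<in>S. a r * kronecker K A q (cohom_class K A q \<phi>) (hom_class K A q (z r)))"
proof -
  interpret Q: quotient_function_space "cycles K A q" "boundaries K A q :: ('a, 'k) chain set"
    by (rule quotient_function_space_homology[OF A])
  let ?c = "\<lambda>\<sigma>. \<Sum>r\<in>S. a r * z r \<sigma>"
  have az: "(\<lambda>\<sigma>. a r * z r \<sigma>) \<in> cycles K A q" if "r \<in> S" for r
    by (rule function_subspaceD(3)[OF function_subspace_cycles z[OF that]])
  have "finsum (homology K A q) (\<lambda>r. a r \<odot>\<^bsub>homology K A q\<^esub> hom_class K A q (z r)) S = hom_class K A q ?c"
    using Q.finsum_Q[of S "\<lambda>r \<sigma>. a r * z r \<sigma>"] az
    by (simp add: homology_def hom_class_eq Q.smult_Q)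
  moreover have "?c \<in> cycles K A q"
    using function_subspace_sum[OF function_subspace_cycles, of S "\<lambda>r \<sigma>. a r * z r \<sigma>" A q] az by simp
  ultimately show ?thesis
    using z by (simp add: kronecker_class[OF A \<phi>] cochain_eval_sum_right)
qed

end

theorem proposition3p3:
  fixes K :: "'a cw_complex"
    and f :: "'a set \<Rightarrow> real"
    and cell :: "nat \<Rightarrow> 'a set"
    and R V :: "'k::field mat"
    and q :: nat and t :: real and u v :: nat
    and w :: "nat \<Rightarrow> nat \<Rightarrow> 'k"
    and \<B> :: "('a, 'k) chain set set"
    and \<alpha> :: "('a, 'k) chain set \<Rightarrow> ('a, 'k) chain set"
  assumes "filtered_cw_complex K f cell"
    and "reduction K cell R V"
    and "t \<in> f ` cells K"
    and "transition_coefficients K f cell R V q t w"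
    and "homology_basis K (sublevel K f t) q \<B>"
    and "(\<lambda>r. hom_class K (sublevel K f t) q (birth_cycle cell V r)) ` surviving K f cell R q t \<subseteq> \<B>"
    and "dual_basis K (sublevel K f t) q \<B> \<alpha>"
    and "u \<in> dying K f cell R q t"
    and "v \<in> surviving K f cell R q t"
  shows "w u v =
           kronecker K (sublevel K f t) q
             (\<alpha> (hom_class K (sublevel K f t) q (birth_cycle cell V v)))
             (incl_homology K (sublevel K f t) q
               (hom_class K (strict_sublevel K f t) q (birth_cycle cell V u)))
       \<and> kronecker K (sublevel K f t) q
             (\<alpha> (hom_class K (sublevel K f t) q (birth_cycle cell V v)))
             (incl_homology K (sublevel K f t) q
               (hom_class K (strict_sublevel K f t) q (birth_cycle cell V u))) =
         kronecker K (strict_sublevel K f t) q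
             (incl_cohomology K (strict_sublevel K f t) q
               (\<alpha> (hom_class K (sublevel K f t) q (birth_cycle cell V v))))
             (hom_class K (strict_sublevel K f t) q (birth_cycle cell V u))"
proof -
  interpret filtered_cw_complex K f cell by (rule assms(1))
  note red = assms(2)
  let ?A = "sublevel K f t" and ?A' = "strict_sublevel K f t"
  let ?S = "surviving K f cell R q t"
  let ?z = "birth_cycle cell V"
  let ?h = "\<lambda>r. hom_class K ?A q (?z r)"
  have A: "cw_subcomplex K ?A" and A': "cw_subcomplex K ?A'"
    by (rule sublevel_subcomplex, rule strict_sublevel_subcomplex)
  have sub: "?A' \<subseteq> ?A" by (rule strict_sublevel_subset)
  have zr: "?z r \<in> cycles K ?A q" if "r \<in> ?S" for r
    using that by (intro birth_cycle_sublevel[OF red]) (auto simp: surviving_def birth_def)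
  have zu': "?z u \<in> cycles K ?A' q"
    using assms(8) by (intro birth_cycle_strict_sublevel[OF red]) (auto simp: dying_def birth_def)
  then have zu: "?z u \<in> cycles K ?A q" using cycles_mono[OF sub] by blast
  have hB: "?h r \<in> \<B>" if "r \<in> ?S" for r using assms(6) that by blast
  interpret Q: quotient_function_space "cocycles K ?A q" "coboundaries K ?A q :: ('a, 'k) chain set"
    by (rule quotient_function_space_cohomology[OF A])
  have "\<alpha> ` \<B> \<subseteq> carrier (cohomology K ?A q)"
    using assms(7) vectorspace.basis_def[OF Q.vectorspace_Q] by (simp add: dual_basis_def cohomology_def)
  then have "\<alpha> (?h v) \<in> carrier (cohomology K ?A q)" using hB[OF assms(9)] by blast
  then obtain \<phi> where \<phi>: "\<phi> \<in> cocycles K ?A q" "\<alpha> (?h v) = cohom_class K ?A q \<phi>"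
    by (auto simp: cohomology_def Q.carrier_Q cohom_class_eq)
  have dual: "kronecker K ?A q (\<alpha> (?h v)) (?h r) = (if r = v then 1 else 0)" if "r \<in> ?S" for r
    using assms(7) hB[OF that] hB[OF assms(9)] inj_onD[OF inj_on_surviving_class[OF red, of t q], of v r] that assms(9)
    by (auto simp: dual_basis_def)
  have incl: "incl_homology K ?A q (hom_class K ?A' q (?z u)) = hom_class K ?A q (?z u)"
    by (rule incl_homology_class[OF sub])
  have "finite ?S" by (simp add: surviving_def intervals_def)
  then have "w u v = (\<Sum>r\<in>?S. w u r * kronecker K ?A q (\<alpha> (?h v)) (?h r))"
    using assms(9) by (simp add: dual if_distrib[where f = "\<lambda>x. _ * x"] cong: if_cong)
  also have "\<dots> = kronecker K ?A q (\<alpha> (?h v)) (incl_homology K ?A q (hom_class K ?A' q (?z u)))"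
    using assms(4,8) kronecker_finsum[OF A \<phi>(1), of ?S ?z "w u"] zr
    by (simp add: transition_coefficients_def \<phi>(2))
  finally have 1: "w u v = kronecker K ?A q (\<alpha> (?h v)) (incl_homology K ?A q (hom_class K ?A' q (?z u)))" .
  have "?z u \<in> chains K ?A' q" using zu' by (simp add: cycles_def)
  then have "kronecker K ?A q (\<alpha> (?h v)) (hom_class K ?A q (?z u))
      = kronecker K ?A' q (incl_cohomology K ?A' q (\<alpha> (?h v))) (hom_class K ?A' q (?z u))"
    unfolding \<phi>(2) incl_cohomology_class[OF A' sub]
    using kronecker_class[OF A \<phi>(1) zu]
      kronecker_class[OF A' restrict_cochain_cocycles[OF A' sub \<phi>(1)] zu']
      cochain_eval_restrict_cochain[OF sub, of "?z u" q \<phi>] by simp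
  with 1 incl show ?thesis by simp
qed

end
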